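(* For a cubic ring $\mathbf B$ let $\mathbf B^*=\operatorname{Hom}_{\mathbf D}(\mathbf B,\mathbf D)$, considered as a $\mathbf B$-module. The duals of cubic rings are as follows, up to isomorphism (with the notation of the five cases given in the context): (i) One branch, ramified case: if $\mathbf B=\mathbf D+t^k\mathbf C_r(\alpha)$, then $\mathbf B^*\simeq\mathbf D+t^{[r/2]}\alpha\mathbf D+t^{k+r}\mathbf A$. (ii) One branch, non-ramified case: if $\mathbf B=\mathbf D+t^k\mathbf C_r(\alpha)$, then $\mathbf B^*\simeq\mathbf D+t^r\alpha\mathbf D+t^{k+2r}\mathbf A$. (iii) Two branches, ramified case: (1) if $\mathbf B=\mathbf D+t^k\mathbf C_{l,q}(\alpha)$, then $\mathbf B^*\simeq\mathbf D+t^l(e+t^q\alpha)\mathbf D+t^{k+2l+q}\mathbf A$; (2) if $\mathbf B=\mathbf D+t^k\mathbf C_r(\alpha)$, then $\mathbf B^*\simeq\mathbf D+t^r\alpha\mathbf D+t^{k+2r+1}\mathbf A$. (iv) Two branches, non-ramified case: if $\mathbf B=\mathbf D+t^k\mathbf C_{l,q}(\alpha)$, then $\mathbf B^*\simeq\mathbf D+t^l(e+t^q\alpha)\mathbf D+t^{k+2l+q}\mathbf A$. (v) Three branches case: if $\mathbf B=\mathbf D+t^k\mathbf C_{l,q}(\alpha)$, then $\mathbf B^*\simeq\mathbf D+t^l\alpha\mathbf D+t^{k+2l+q}\mathbf A$.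
   Context: $\mathbf D$ is a complete discrete valuation ring with field of fractions $\mathbf K$, maximal ideal $t\mathbf D$ and residue field $\mathbf k=\mathbf D/t\mathbf D$. $\mathbf L$ is a $3$-dimensional (commutative) semisimple $\mathbf K$-algebra. A cubic ring over $\mathbf D$ (in $\mathbf L$) is a $\mathbf D$-subalgebra of $\mathbf L$ that is a free $\mathbf D$-module of rank $3$. $\mathbf A$ is the integral closure of $\mathbf D$ in $\mathbf L$, assumed to be a finitely generated $\mathbf D$-module. $[x]$ denotes the integer part of $x$; $k,r,l,q$ are non-negative integers. The five cases and the corresponding rings are: (i) One branch, ramified: $\mathbf L$ is a field, the maximal ideal of $\mathbf A$ is $\tau\mathbf A$, $\mathbf A/\tau\mathbf A\simeq\mathbf k$, $t\mathbf A=\tau^3\mathbf A$, $v$ is the normalized valuation of $\mathbf A$. $\mathbf C_{2r}(\alpha)=\mathbf D+t^r\alpha\mathbf D+t^{2r}\mathbf A$ with $v(\alpha)=1$; $\mathbf C_{2r+1}(\alpha)=\mathbf D+t^r\alpha\mathbf D+t^{2r+1}\mathbf A$ with $v(\alpha)=2$. (ii) One branch, non-ramified: $\mathbf L$ is a field, the maximal ideal of $\mathbf A$ is $t\mathbf A$, $\mathbf A/t\mathbf A$ is a cubic field extension of $\mathbf k$. $\mathbf C_r(\alpha)=\mathbf D+t^r\alpha\mathbf D+t^{2r}\mathbf A$ with $\alpha\in\mathbf A^\times\setminus\mathbf D$. (iii) Two branches, ramified: $\mathbf L=\mathbf K_1\times\mathbf K$ with $\mathbf K_1$ a quadratic field extension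 of $\mathbf K$, $\mathbf A=\mathbf D_1\times\mathbf D$, the maximal ideal of $\mathbf D_1$ is $\tau\mathbf D_1$, $\mathbf D_1/\tau\mathbf D_1\simeq\mathbf k$, $t\mathbf D_1=\tau^2\mathbf D_1$; $e$ is the idempotent with $e\mathbf A=\mathbf D_1$ and $v$ is the normalized valuation of $\mathbf D_1$. $\mathbf C_{l,q}(\alpha)=\mathbf D+t^l(e+t^q\alpha)\mathbf D+t^{2l+q}\mathbf A$ and $\mathbf C_r(\alpha)=\mathbf D+t^r\alpha\mathbf D+t^{2r+1}\mathbf A$, with $\alpha\in\mathbf D_1$, $v(\alpha)=1$. (iv) Two branches, non-ramified: $\mathbf L=\mathbf K_1\times\mathbf K$ with $\mathbf K_1$ a quadratic field extension of $\mathbf K$, $\mathbf A=\mathbf D_1\times\mathbf D$, the maximal ideal of $\mathbf D_1$ is $t\mathbf D_1$, $\mathbf D_1/t\mathbf D_1$ is a quadratic field extension of $\mathbf k$; $e$ is the idempotent with $e\mathbf A=\mathbf D_1$. $\mathbf C_{l,q}(\alpha)=\mathbf D+t^l(e+t^q\alpha)\mathbf D+t^{2l+q}\mathbf A$ with $\alpha\in\mathbf D_1\setminus(e\mathbf D+t\mathbf D_1)$. (v) Three branches: $\mathbf L=\mathbf K^3$, $\mathbf A=\mathbf D^3$. $\mathbf C_{l,q}(\alpha)=\mathbf D+t^l\alpha\mathbf D+t^{2l+q}\mathbf A$, where $\alpha=e+t^qae'$, $e\ne e'$ are primitive idempotents of $\mathbf A$, $a\in\mathbf D^\times$, and $a\not\equiv1\pmod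 t$ if $q=0$. In (iii)–(v), $\mathbf D$ is embedded diagonally in $\mathbf A$; in (iii) and (iv), $\mathbf D_1$ is identified with $e\mathbf A$.
   Formalization: In case (ii) the condition α ∈ A^× \ D is replaced by α ∈ A^× with α ∉ D + tA; as printed the claim fails, e.g. for α = 1 + tβ with β ∈ A \ D, r = 0, k = 1, where B = D + tA is not isomorphic to its dual. *)

theory Defs
  imports
    "HOL-Algebra.Ring_Divisibility"
    "HOL-Algebra.Embedded_Algebras"
    "HOL-Algebra.Chinese_Remainder"
    "HOL-Algebra.Module"
    "HOL-Library.Set_Algebras"
    "HOL-Library.Extended_Nat"
    "HOL-Computational_Algebra.Polynomial"
begin

text \<open>
  The algebra \<open>L\<close> is a type \<open>'a :: comm_ring_1\<close>; the field \<open>K\<close> and the ring \<open>D\<close> are identified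
  with their images in \<open>L\<close>. (A non-zero unital \<open>K\<close>-algebra contains \<open>K\<close>; for \<open>L = K \<times> K \<times> K\<close> or
  \<open>L = K\<^sub>1 \<times> K\<close> the image is the diagonal.) Sums and multiples of subsets of \<open>L\<close>, such as
  \<open>D + x *o D\<close>, are those of \<^theory>\<open>HOL-Library.Set_Algebras\<close>.
\<close>

text \<open>
  A subset of \<open>L\<close> as a ring record. The unit \<open>u\<close> is a parameter because the factors of \<open>L\<close> are
  rings \<open>e L\<close> whose unit is the idempotent \<open>e\<close>.
\<close>

definition ring_on :: "'a::comm_ring_1 \<Rightarrow> 'a set \<Rightarrow> 'a ring" where
  "ring_on u S = \<lparr>carrier = S, monoid.mult = (*), one = u, zero = 0, add = (+)\<rparr>"

abbreviation whole_ring :: "'a::comm_ring_1 ring" where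
  "whole_ring \<equiv> ring_on 1 UNIV"

definition field_extension_degree :: "('b, 'm) ring_scheme \<Rightarrow> 'b set \<Rightarrow> nat \<Rightarrow> bool" where
  "field_extension_degree R F n \<longleftrightarrow>
     field R \<and> subfield F R \<and> ring.dimension R n F (carrier R)"

definition unique_maximal_ideal :: "('b, 'm) ring_scheme \<Rightarrow> 'b set \<Rightarrow> bool" where
  "unique_maximal_ideal R M \<longleftrightarrow> {I. maximalideal I R} = {M}"

definition semisimple_ring :: "'a::comm_ring_1 itself \<Rightarrow> bool" where
  "semisimple_ring _ \<longleftrightarrow>
     (\<forall>I. ideal I (whole_ring :: 'a ring) \<longrightarrow>
        (\<exists>J. ideal J (whole_ring :: 'a ring) \<and> I \<inter> J = {0} \<and> I + J = UNIV))"

definition adically_complete :: "'a::comm_ring_1 set \<Rightarrow> 'a \<Rightarrow> bool" where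
  "adically_complete D t \<longleftrightarrow>
     (\<forall>x :: nat \<Rightarrow> 'a. range x \<subseteq> D \<longrightarrow>
        (\<forall>N. \<exists>n\<^sub>0. \<forall>m\<ge>n\<^sub>0. \<forall>n\<ge>n\<^sub>0. x m - x n \<in> (t ^ N) *o D) \<longrightarrow>
        (\<exists>y\<in>D. \<forall>N. \<exists>n\<^sub>0. \<forall>n\<ge>n\<^sub>0. x n - y \<in> (t ^ N) *o D))"

definition complete_dvr :: "'a::comm_ring_1 set \<Rightarrow> 'a \<Rightarrow> bool" where
  "complete_dvr D t \<longleftrightarrow>
     principal_domain (ring_on 1 D) \<and> \<not> field (ring_on 1 D) \<and>
     t \<in> D \<and> unique_maximal_ideal (ring_on 1 D) (t *o D) \<and>
     adically_complete D t"

definition field_of_fractions :: "'a::comm_ring_1 set \<Rightarrow> 'a set \<Rightarrow> bool" where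
  "field_of_fractions D K \<longleftrightarrow>
     D \<subseteq> K \<and> (\<forall>x\<in>K. \<exists>a\<in>D. \<exists>b\<in>D. b \<noteq> 0 \<and> x * b = a)"

definition integral_closure :: "'a::comm_ring_1 set \<Rightarrow> 'a set" where
  "integral_closure D =
     {x. \<exists>p :: 'a poly. lead_coeff p = 1 \<and> set (coeffs p) \<subseteq> D \<and> poly p x = 0}"

definition fg_module :: "'a::comm_ring_1 set \<Rightarrow> 'a set \<Rightarrow> bool" where
  "fg_module D M \<longleftrightarrow>
     (\<exists>S. finite S \<and> M = {(\<Sum>s\<in>S. c s * s) | c. c \<in> S \<rightarrow> D})"

locale cubic_setting =
  fixes K D A :: "'a::comm_ring_1 set" and t :: 'a
  assumes K_subfield: "subfield K whole_ring"
    and D_subring: "subring D whole_ring"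
    and D_complete_dvr: "complete_dvr D t"
    and K_fractions: "field_of_fractions D K"
    and L_dimension: "ring.dimension whole_ring 3 K UNIV"
    and L_semisimple: "semisimple_ring TYPE('a)"
    and A_def: "A = integral_closure D"
    and A_fg: "fg_module D A"

definition cubic_ring :: "'a::comm_ring_1 set \<Rightarrow> 'a set \<Rightarrow> bool" where
  "cubic_ring D B \<longleftrightarrow>
     subring B whole_ring \<and> D \<subseteq> B \<and>
     (\<exists>b\<^sub>1 b\<^sub>2 b\<^sub>3. bij_betw (\<lambda>(x, y, z). x * b\<^sub>1 + y * b\<^sub>2 + z * b\<^sub>3) (D \<times> D \<times> D) B)"

text \<open>
  In the next two definitions the \<open>mult\<close> and \<open>one\<close> fields of the records play no role in the
  module structure.
\<close>

definition dual_module :: "'a::comm_ring_1 set \<Rightarrow> 'a set \<Rightarrow> ('a, 'a \<Rightarrow> 'a) module" where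
  "dual_module D B =
     \<lparr>carrier = {f \<in> B \<rightarrow>\<^sub>E D. (\<forall>x\<in>B. \<forall>y\<in>B. f (x + y) = f x + f y) \<and>
                           (\<forall>d\<in>D. \<forall>x\<in>B. f (d * x) = d * f x)},
      monoid.mult = undefined, one = undefined,
      zero = (\<lambda>x\<in>B. 0), add = (\<lambda>f g. \<lambda>x\<in>B. f x + g x),
      module.smult = (\<lambda>b f. \<lambda>x\<in>B. f (b * x))\<rparr>"

definition module_on :: "'a::comm_ring_1 set \<Rightarrow> ('a, 'a) module" where
  "module_on M =
     \<lparr>carrier = M, monoid.mult = (*), one = 1, zero = 0, add = (+), module.smult = (*)\<rparr>"

definition module_isomorphic ::
    "('r, 'k) ring_scheme \<Rightarrow> ('r, 'b, 'm) module_scheme \<Rightarrow> ('r, 'c, 'n) module_scheme \<Rightarrow> bool" where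
  "module_isomorphic R M N \<longleftrightarrow>
     module R M \<and> module R N \<and>
     (\<exists>f. bij_betw f (carrier M) (carrier N) \<and>
        (\<forall>x\<in>carrier M. \<forall>y\<in>carrier M. f (x \<oplus>\<^bsub>M\<^esub> y) = f x \<oplus>\<^bsub>N\<^esub> f y) \<and>
        (\<forall>r\<in>carrier R. \<forall>x\<in>carrier M. f (r \<odot>\<^bsub>M\<^esub> x) = r \<odot>\<^bsub>N\<^esub> f x))"

definition dual_isomorphic_to :: "'a::comm_ring_1 set \<Rightarrow> 'a set \<Rightarrow> 'a set \<Rightarrow> bool" where
  "dual_isomorphic_to D B M \<longleftrightarrow>
     module_isomorphic (ring_on 1 B) (dual_module D B) (module_on M)"

text \<open>
  The normalized valuation of a discrete valuation ring \<open>S\<close> with maximal ideal \<open>\<tau> S\<close>, for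
  arguments in \<open>S\<close>; the value at \<open>0\<close> is \<open>\<infinity>\<close>.
\<close>

definition normalized_valuation :: "'a::comm_ring_1 set \<Rightarrow> 'a \<Rightarrow> 'a \<Rightarrow> enat" where
  "normalized_valuation S \<tau> x = (SUP n\<in>{n. x \<in> (\<tau> ^ n) *o S}. enat n)"

text \<open>
  For a ring \<open>S\<close> with unit \<open>e\<close> that is a \<open>D\<close>-algebra via \<open>d \<mapsto> e d\<close>, and an ideal \<open>P\<close> of \<open>S\<close>:
  \<open>S / P\<close> is a field extension of degree \<open>n\<close> of the residue field of \<open>D\<close>, which is identified
  with the image of \<open>D\<close> in \<open>S / P\<close>.
\<close>

definition residue_extension_degree ::
    "'a::comm_ring_1 set \<Rightarrow> 'a \<Rightarrow> 'a set \<Rightarrow> 'a set \<Rightarrow> nat \<Rightarrow> bool" where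
  "residue_extension_degree D e S P n \<longleftrightarrow>
     field_extension_degree (ring_on e S Quot P) ((\<lambda>d. P +>\<^bsub>ring_on e S\<^esub> (e * d)) ` D) n"

definition primitive_idempotent :: "'a::comm_ring_1 set \<Rightarrow> 'a \<Rightarrow> bool" where
  "primitive_idempotent A e \<longleftrightarrow>
     e \<in> A \<and> e * e = e \<and> e \<noteq> 0 \<and>
     (\<forall>f\<in>A. \<forall>g\<in>A. f * f = f \<and> g * g = g \<and> f * g = 0 \<and> e = f + g \<longrightarrow> f = 0 \<or> g = 0)"


section \<open>The five cases\<close>

definition one_branch_ramified :: "'a::comm_ring_1 set \<Rightarrow> 'a set \<Rightarrow> 'a \<Rightarrow> 'a \<Rightarrow> bool" where
  "one_branch_ramified D A t \<tau> \<longleftrightarrow>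
     field (whole_ring :: 'a ring) \<and>
     \<tau> \<in> A \<and> unique_maximal_ideal (ring_on 1 A) (\<tau> *o A) \<and>
     (ring_on 1 A Quot (\<tau> *o A)) \<simeq> (ring_on 1 D Quot (t *o D)) \<and>
     t *o A = (\<tau> ^ 3) *o A"

definition one_branch_unramified :: "'a::comm_ring_1 set \<Rightarrow> 'a set \<Rightarrow> 'a \<Rightarrow> bool" where
  "one_branch_unramified D A t \<longleftrightarrow>
     field (whole_ring :: 'a ring) \<and>
     unique_maximal_ideal (ring_on 1 A) (t *o A) \<and>
     residue_extension_degree D 1 A (t *o A) 3"

text \<open>
  \<open>L = K\<^sub>1 \<times> K\<close>, where \<open>K\<^sub>1\<close> is realized as the ring \<open>e L\<close> with unit \<open>e\<close>, the first projection
  is multiplication by \<open>e\<close>, and \<open>K\<close> is embedded diagonally.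
  Consequently \<open>D\<^sub>1 = e A = e *o A\<close>.
\<close>

definition two_branches :: "'a::comm_ring_1 set \<Rightarrow> 'a \<Rightarrow> bool" where
  "two_branches K e \<longleftrightarrow>
     e * e = e \<and>
     field_extension_degree (ring_on e (e *o UNIV)) (e *o K) 2 \<and>
     (\<exists>\<phi> \<in> ring_iso whole_ring (RDirProd (ring_on e (e *o UNIV)) (ring_on 1 K)).
        (\<forall>x. fst (\<phi> x) = e * x) \<and> (\<forall>x\<in>K. snd (\<phi> x) = x))"

definition two_branches_ramified ::
    "'a::comm_ring_1 set \<Rightarrow> 'a set \<Rightarrow> 'a set \<Rightarrow> 'a \<Rightarrow> 'a \<Rightarrow> 'a \<Rightarrow> bool" where
  "two_branches_ramified K D A t e \<tau> \<longleftrightarrow>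
     two_branches K e \<and>
     \<tau> \<in> e *o A \<and> unique_maximal_ideal (ring_on e (e *o A)) (\<tau> *o (e *o A)) \<and>
     (ring_on e (e *o A) Quot (\<tau> *o (e *o A))) \<simeq> (ring_on 1 D Quot (t *o D)) \<and>
     t *o (e *o A) = (\<tau> ^ 2) *o (e *o A)"

definition two_branches_unramified ::
    "'a::comm_ring_1 set \<Rightarrow> 'a set \<Rightarrow> 'a set \<Rightarrow> 'a \<Rightarrow> 'a \<Rightarrow> bool" where
  "two_branches_unramified K D A t e \<longleftrightarrow>
     two_branches K e \<and>
     unique_maximal_ideal (ring_on e (e *o A)) (t *o (e *o A)) \<and>
     residue_extension_degree D e (e *o A) (t *o (e *o A)) 2"

definition three_branches :: "'a::comm_ring_1 set \<Rightarrow> bool" where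
  "three_branches K \<longleftrightarrow>
     (\<exists>\<phi> \<in> ring_iso whole_ring (RDirProd (ring_on 1 K) (RDirProd (ring_on 1 K) (ring_on 1 K))).
        \<forall>x\<in>K. \<phi> x = (x, x, x))"


section \<open>Admissible parameters and the corresponding rings\<close>

text \<open>
  The one-branch ramified rings with index \<open>2r\<close> and \<open>2r + 1\<close> are
  \<open>D + t\<^sup>r\<alpha>D + t\<^sup>2\<^sup>rA\<close> with \<open>v(\<alpha>) = 1\<close> and \<open>D + t\<^sup>r\<alpha>D + t\<^sup>2\<^sup>r\<^sup>+\<^sup>1A\<close> with \<open>v(\<alpha>) = 2\<close>;
  both are written here in terms of the index \<open>r\<close> itself.
\<close>

definition admissible_one_ramified :: "'a::comm_ring_1 set \<Rightarrow> 'a \<Rightarrow> nat \<Rightarrow> 'a \<Rightarrow> bool" where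
  "admissible_one_ramified A \<tau> r \<alpha> \<longleftrightarrow>
     \<alpha> \<in> A \<and> normalized_valuation A \<tau> \<alpha> = (if even r then 1 else 2)"

definition C_one_ramified ::
    "'a::comm_ring_1 set \<Rightarrow> 'a set \<Rightarrow> 'a \<Rightarrow> nat \<Rightarrow> 'a \<Rightarrow> 'a set" where
  "C_one_ramified D A t r \<alpha> = D + (t ^ (r div 2) * \<alpha>) *o D + (t ^ r) *o A"

text \<open>
  The parameter is a unit of \<open>A\<close> that is not in \<open>D\<close> modulo \<open>t\<close>, that is, whose residue does not
  lie in the residue field of \<open>D\<close>. It is not enough that \<open>\<alpha> \<notin> D\<close>: for \<open>\<alpha> = 1 + t \<beta>\<close> with
  \<open>\<beta> \<in> A - D\<close>, \<open>r = 0\<close> and \<open>k = 1\<close> both \<open>D + t\<^sup>k C\<^sub>r(\<alpha>)\<close> and \<open>D + t\<^sup>r \<alpha> D + t\<^sup>k\<^sup>+\<^sup>2\<^sup>r A\<close> are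
  \<open>D + t A\<close>, which is not Gorenstein and hence not isomorphic to its dual.
\<close>

definition admissible_one_unramified :: "'a::comm_ring_1 set \<Rightarrow> 'a set \<Rightarrow> 'a \<Rightarrow> 'a \<Rightarrow> bool" where
  "admissible_one_unramified D A t \<alpha> \<longleftrightarrow> \<alpha> \<in> Units (ring_on 1 A) \<and> \<alpha> \<notin> D + t *o A"

definition C_one_unramified ::
    "'a::comm_ring_1 set \<Rightarrow> 'a set \<Rightarrow> 'a \<Rightarrow> nat \<Rightarrow> 'a \<Rightarrow> 'a set" where
  "C_one_unramified D A t r \<alpha> = D + (t ^ r * \<alpha>) *o D + (t ^ (2 * r)) *o A"

definition admissible_two_ramified :: "'a::comm_ring_1 set \<Rightarrow> 'a \<Rightarrow> 'a \<Rightarrow> 'a \<Rightarrow> bool" where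
  "admissible_two_ramified A e \<tau> \<alpha> \<longleftrightarrow>
     \<alpha> \<in> e *o A \<and> normalized_valuation (e *o A) \<tau> \<alpha> = 1"

definition admissible_two_unramified ::
    "'a::comm_ring_1 set \<Rightarrow> 'a set \<Rightarrow> 'a \<Rightarrow> 'a \<Rightarrow> 'a \<Rightarrow> bool" where
  "admissible_two_unramified D A t e \<alpha> \<longleftrightarrow>
     \<alpha> \<in> e *o A \<and> \<alpha> \<notin> e *o D + t *o (e *o A)"

definition C_two ::
    "'a::comm_ring_1 set \<Rightarrow> 'a set \<Rightarrow> 'a \<Rightarrow> 'a \<Rightarrow> nat \<Rightarrow> nat \<Rightarrow> 'a \<Rightarrow> 'a set" where
  "C_two D A t e l q \<alpha> =
     D + (t ^ l * (e + t ^ q * \<alpha>)) *o D + (t ^ (2 * l + q)) *o A"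

definition C_two_ramified ::
    "'a::comm_ring_1 set \<Rightarrow> 'a set \<Rightarrow> 'a \<Rightarrow> nat \<Rightarrow> 'a \<Rightarrow> 'a set" where
  "C_two_ramified D A t r \<alpha> = D + (t ^ r * \<alpha>) *o D + (t ^ (2 * r + 1)) *o A"

definition admissible_three ::
    "'a::comm_ring_1 set \<Rightarrow> 'a set \<Rightarrow> 'a \<Rightarrow> nat \<Rightarrow> 'a \<Rightarrow> bool" where
  "admissible_three D A t q \<alpha> \<longleftrightarrow>
     (\<exists>e e' a. primitive_idempotent A e \<and> primitive_idempotent A e' \<and> e \<noteq> e' \<and>
        a \<in> Units (ring_on 1 D) \<and> (q = 0 \<longrightarrow> a - 1 \<notin> t *o D) \<and>
        \<alpha> = e + t ^ q * a * e')"

definition C_three ::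
    "'a::comm_ring_1 set \<Rightarrow> 'a set \<Rightarrow> 'a \<Rightarrow> nat \<Rightarrow> nat \<Rightarrow> 'a \<Rightarrow> 'a set" where
  "C_three D A t l q \<alpha> = D + (t ^ l * \<alpha>) *o D + (t ^ (2 * l + q)) *o A"

end

theory Submission
  imports Defs
begin

text \<open>
  In every case \<open>C = D + \<beta> D + t\<^sup>m A\<close> turns out to be the monogenic ring \<open>D[\<beta>]\<close>, where \<open>\<beta> = t\<^sup>s \<nu>\<close>: one finds
  \<open>\<delta>\<close> such that \<open>1, \<nu>, \<delta>\<close> is a \<open>D\<close>-basis of \<open>A\<close> and \<open>\<beta>\<^sup>2 \<in> \<beta> D + t\<^sup>m \<delta>\<close>. Then \<open>B = D + t\<^sup>k C\<close> has the basis
  \<open>1, t\<^sup>k \<beta>, t\<^sup>k \<beta>\<^sup>2\<close>, the claimed dual \<open>M\<close> has the basis \<open>1, \<beta>, t\<^sup>k \<beta>\<^sup>2\<close>, and \<open>(x, y) \<mapsto> \<phi> (x y)\<close>, with \<open>\<phi>\<close> the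
  coefficient of \<open>t\<^sup>k \<beta>\<^sup>2\<close>, is a perfect pairing \<open>B \<times> M \<rightarrow> D\<close>.

  Since any four elements of \<open>L\<close> are linearly dependent over \<open>D\<close> with a unit among the coefficients,
  three elements of \<open>A\<close> that are independent modulo \<open>t A\<close> already form a basis of \<open>A\<close>. Independence
  modulo \<open>t A\<close> is a comparison of valuations in the ramified cases; the residue field is needed only
  to see that a residue outside of \<open>k\<close> has degree three in case (ii).
\<close>

section \<open>Subsets of \<open>L\<close> as rings and modules\<close>

text \<open>The factor t^k is what separates \<open>B\<close> from the claimed dual
  \<open>M\<close>: their bases differ only in the middle vector, t^k \<beta> against \<beta>, so
  that the product of the two middle vectors is again t^k \<beta>^2. For k = 0 both modules are C.

  The real work is the choice of \<delta>. The square of \<nu> cannot always serve: it may be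
  divisible by t (in some ramified rings) or congruent to \<nu> modulo t (in the rings built on an
  idempotent). So \<beta>^2 is corrected by a multiple d \<beta>, with d = t^l for the rings indexed
  by l and q and d = 0 otherwise, and the rest is divided by t^m. The exponent m of each family is
  the one for which the quotient \<delta> completes 1, \<nu> to a basis modulo t A.

  When \<open>L\<close> is not a field it has zero divisors. Cancellation therefore rests on
  non-zero elements of \<open>K\<close>, which are invertible in \<open>L\<close>, and divisibility
  inside a single branch is tested by multiplying with an idempotent.\<close>

lemma ring_on_simps [simp]:
  "carrier (ring_on u S) = S" "x \<otimes>\<^bsub>ring_on u S\<^esub> y = x * y" "\<one>\<^bsub>ring_on u S\<^esub> = u"
  "\<zero>\<^bsub>ring_on u S\<^esub> = 0" "x \<oplus>\<^bsub>ring_on u S\<^esub> y = x + y"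
  by (simp_all add: ring_on_def)

lemma mem_elt_times: "x \<in> c *o S \<longleftrightarrow> (\<exists>y\<in>S. x = c * y)"
  by (auto simp: elt_set_times_def)

lemma zero_mem_elt_times: "(0 :: 'a::comm_ring_1) \<in> S \<Longrightarrow> 0 \<in> c *o S"
  using set_times_intro2[of 0 S c] by simp

lemma cring_ring_on:
  assumes "0 \<in> S" "u \<in> S" and "\<And>x y. x \<in> S \<Longrightarrow> y \<in> S \<Longrightarrow> x + y \<in> S"
    and "\<And>x. x \<in> S \<Longrightarrow> - x \<in> S" and "\<And>x y. x \<in> S \<Longrightarrow> y \<in> S \<Longrightarrow> x * y \<in> S"
    and "\<And>x. x \<in> S \<Longrightarrow> u * x = x"
  shows "cring (ring_on u S)"
proof (intro cringI abelian_groupI comm_monoidI; (simp add: assms algebra_simps)?)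
  fix x assume "x \<in> S"
  then show "\<exists>y\<in>S. x + y = 0" using assms(4) by (intro bexI[of _ "- x"]) auto
qed (use assms(6) in \<open>auto simp: mult.commute[of _ u]\<close>)

lemma cring_whole_ring: "cring (whole_ring :: 'a::comm_ring_1 ring)"
  by (rule cring_ring_on) auto

lemma subring_whole_ringD:
  assumes "subring S (whole_ring :: 'a::comm_ring_1 ring)"
  shows "0 \<in> S" "1 \<in> S" "x \<in> S \<Longrightarrow> - x \<in> S" "x \<in> S \<Longrightarrow> y \<in> S \<Longrightarrow> x * y \<in> S"
    "x \<in> S \<Longrightarrow> y \<in> S \<Longrightarrow> x + y \<in> S" "x \<in> S \<Longrightarrow> y \<in> S \<Longrightarrow> x - y \<in> S" "x \<in> S \<Longrightarrow> x ^ n \<in> S"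
proof -
  interpret W: cring "whole_ring :: 'a ring" by (rule cring_whole_ring)
  show 0: "0 \<in> S" and 1: "1 \<in> S" and mult: "\<And>x y. x \<in> S \<Longrightarrow> y \<in> S \<Longrightarrow> x * y \<in> S"
    and add: "\<And>x y. x \<in> S \<Longrightarrow> y \<in> S \<Longrightarrow> x + y \<in> S"
    using subringE[OF assms] by auto
  have "\<ominus>\<^bsub>whole_ring\<^esub> y = - y" for y :: 'a
    by (rule W.minus_equality) auto
  then show minus: "- x \<in> S" if "x \<in> S" for x
    using subringE(5)[OF assms that] by simp
  show "x - y \<in> S" if "x \<in> S" "y \<in> S"
    using add[OF that(1) minus[OF that(2)]] by simp
  show "x ^ n \<in> S" if "x \<in> S"
    using that by (induction n) (auto intro: 1 mult)
qed

lemma cring_ring_on_subring: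
  "subring S (whole_ring :: 'a::comm_ring_1 ring) \<Longrightarrow> cring (ring_on 1 S)"
  by (rule cring_ring_on) (auto intro: subring_whole_ringD)

lemma module_dual_module:
  fixes B D :: "'a::comm_ring_1 set"
  assumes D: "subring D whole_ring" and B: "subring B whole_ring" and DB: "D \<subseteq> B"
  shows "module (ring_on 1 B) (dual_module D B)"
proof (rule moduleI)
  show "cring (ring_on 1 B)" by (rule cring_ring_on_subring[OF B])
  show "abelian_group (dual_module D B)"
  proof (rule abelian_groupI)
    fix f assume "f \<in> carrier (dual_module D B)"
    then show "\<exists>g\<in>carrier (dual_module D B). g \<oplus>\<^bsub>dual_module D B\<^esub> f = \<zero>\<^bsub>dual_module D B\<^esub>"
      using DB by (intro bexI[of _ "\<lambda>x\<in>B. - f x"])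
        (auto simp: dual_module_def PiE_iff subset_iff subring_whole_ringD[OF B]
          subring_whole_ringD(3)[OF D] intro!: ext)
  next
    fix f assume "f \<in> carrier (dual_module D B)"
    then show "\<zero>\<^bsub>dual_module D B\<^esub> \<oplus>\<^bsub>dual_module D B\<^esub> f = f"
      by (auto simp: dual_module_def PiE_iff extensional_def fun_eq_iff)
  qed (use DB in \<open>auto simp: dual_module_def PiE_iff fun_eq_iff algebra_simps subset_iff
        subring_whole_ringD[OF B] subring_whole_ringD(1,5)[OF D]\<close>)
next
  fix b f assume "b \<in> carrier (ring_on 1 B)" "f \<in> carrier (dual_module D B)"
  then show "b \<odot>\<^bsub>dual_module D B\<^esub> f \<in> carrier (dual_module D B)"
    using DB by (auto simp: dual_module_def PiE_iff distrib_left mult.left_commute[of b] subset_iff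
        subring_whole_ringD[OF B])
qed (use DB in \<open>auto simp: dual_module_def PiE_iff extensional_def fun_eq_iff algebra_simps subset_iff
       subring_whole_ringD[OF B]\<close>)

lemma module_module_on:
  fixes B M :: "'a::comm_ring_1 set"
  assumes B: "subring B whole_ring" and "0 \<in> M"
    and add: "\<And>x y. x \<in> M \<Longrightarrow> y \<in> M \<Longrightarrow> x + y \<in> M"
    and mult: "\<And>b x. b \<in> B \<Longrightarrow> x \<in> M \<Longrightarrow> b * x \<in> M"
  shows "module (ring_on 1 B) (module_on M)"
proof (rule moduleI)
  show "cring (ring_on 1 B)" by (rule cring_ring_on_subring[OF B])
  show "abelian_group (module_on M)"
  proof (rule abelian_groupI)
    fix x assume "x \<in> carrier (module_on M)"
    then show "\<exists>y\<in>carrier (module_on M). y \<oplus>\<^bsub>module_on M\<^esub> x = \<zero>\<^bsub>module_on M\<^esub>"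
      using mult[of "- 1" x] subring_whole_ringD[OF B]
      by (intro bexI[of _ "- x"]) (auto simp: module_on_def)
  qed (use assms in \<open>auto simp: module_on_def algebra_simps\<close>)
qed (use assms in \<open>auto simp: module_on_def algebra_simps\<close>)

section \<open>Duality for a monogenic ring\<close>

text \<open>The pairing yields a map from \<open>M\<close> to the dual of \<open>B\<close>, whereas
  \<open>dual_isomorphic_to\<close> has the dual on the left.\<close>

lemma module_isomorphic_sym:
  assumes "module_isomorphic R M N"
  shows "module_isomorphic R N M"
proof -
  obtain f where M: "module R M" and N: "module R N" and bij: "bij_betw f (carrier M) (carrier N)"
    and add: "\<And>x y. x \<in> carrier M \<Longrightarrow> y \<in> carrier M \<Longrightarrow> f (x \<oplus>\<^bsub>M\<^esub> y) = f x \<oplus>\<^bsub>N\<^esub> f y"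
    and smult: "\<And>r x. r \<in> carrier R \<Longrightarrow> x \<in> carrier M \<Longrightarrow> f (r \<odot>\<^bsub>M\<^esub> x) = r \<odot>\<^bsub>N\<^esub> f x"
    using assms unfolding module_isomorphic_def by blast
  interpret M: module R M by fact
  let ?g = "inv_into (carrier M) f"
  have inj: "inj_on f (carrier M)" and im: "f ` carrier M = carrier N"
    using bij by (auto simp: bij_betw_def)
  have g: "?g y \<in> carrier M" "f (?g y) = y" if "y \<in> carrier N" for y
    using that im by (auto intro: inv_into_into f_inv_into_f)
  have "?g (x \<oplus>\<^bsub>N\<^esub> y) = ?g x \<oplus>\<^bsub>M\<^esub> ?g y" if "x \<in> carrier N" "y \<in> carrier N" for x y
    using that g by (intro inv_into_f_eq[OF inj]) (auto simp: add)
  moreover have "?g (r \<odot>\<^bsub>N\<^esub> x) = r \<odot>\<^bsub>M\<^esub> ?g x" if "r \<in> carrier R" "x \<in> carrier N" for r x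
    using that g by (intro inv_into_f_eq[OF inj]) (auto simp: smult)
  ultimately show ?thesis
    unfolding module_isomorphic_def using M N bij_betw_inv_into[OF bij] by blast
qed

text \<open>
  The Gram matrix of the pairing in the given bases is antitriangular with ones on the antidiagonal.
\<close>

lemma dual_isomorphic_to_monogenic:
  fixes B D :: "'a::comm_ring_1 set"
  assumes D: "subring D whole_ring" and B: "subring B whole_ring" and c: "c \<in> D"
    and c_cancel: "\<And>x. c * x = 0 \<Longrightarrow> x = 0"
    and indep: "\<And>x y z. x \<in> D \<Longrightarrow> y \<in> D \<Longrightarrow> z \<in> D \<Longrightarrow> x + y * b + z * b\<^sup>2 = 0 \<Longrightarrow> x = 0 \<and> y = 0 \<and> z = 0"
    and cube: "a0 \<in> D" "a1 \<in> D" "a2 \<in> D" "b ^ 3 = a0 + a1 * b + a2 * b\<^sup>2"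
    and B_eq: "B = {x + y * (c * b) + z * (c * b\<^sup>2) | x y z. x \<in> D \<and> y \<in> D \<and> z \<in> D}"
    and M_eq: "M = {x + y * b + z * (c * b\<^sup>2) | x y z. x \<in> D \<and> y \<in> D \<and> z \<in> D}"
  shows "dual_isomorphic_to D B M"
proof -
  note Dc [simp] = subring_whole_ringD[OF D] c cube(1-3)
  note D_add = subring_whole_ringD(5)[OF D]
  note Bc [simp] = subring_whole_ringD[OF B]
  have DB: "D \<subseteq> B"
  proof
    fix x assume "x \<in> D"
    then have "x = x + 0 * (c * b) + 0 * (c * b\<^sup>2) \<and> x \<in> D \<and> 0 \<in> D" by simp
    then show "x \<in> B" unfolding B_eq by blast
  qed
  have BI: "x + y * (c * b) + z * (c * b\<^sup>2) \<in> B" if "x \<in> D" "y \<in> D" "z \<in> D" for x y z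
    unfolding B_eq using that by blast
  have MI: "x + y * b + z * (c * b\<^sup>2) \<in> M" if "x \<in> D" "y \<in> D" "z \<in> D" for x y z
    unfolding M_eq using that by blast
  define coords where "coords x y z = x + y * b + z * (c * b\<^sup>2)" for x y z
  \<comment> \<open>The third coordinate. It is unique because the difference of two expansions is a
    relation between 1, b, b^2 whose last coefficient is a multiple of the cancellable
    \<open>c\<close>.\<close>
  define \<phi> where "\<phi> m = (THE z. \<exists>x\<in>D. \<exists>y\<in>D. z \<in> D \<and> m = coords x y z)" for m
  have \<phi>: "\<phi> (coords x y z) = z" if "x \<in> D" "y \<in> D" "z \<in> D" for x y z
    unfolding \<phi>_def
  proof (rule the_equality)
    fix z' assume "\<exists>x'\<in>D. \<exists>y'\<in>D. z' \<in> D \<and> coords x y z = coords x' y' z'"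
    then obtain x' y' where *: "x' \<in> D" "y' \<in> D" "z' \<in> D" "coords x y z = coords x' y' z'"
      by blast
    then have "(x - x') + (y - y') * b + (z - z') * c * b\<^sup>2 = 0"
      by (simp add: coords_def algebra_simps)
    then have "(z - z') * c = 0" using indep[of "x - x'" "y - y'" "(z - z') * c"] * that by auto
    then show "z' = z" using c_cancel[of "z - z'"] by (simp add: mult.commute)
  qed (use that in blast)
  have M_coords: "M = {coords x y z | x y z. x \<in> D \<and> y \<in> D \<and> z \<in> D}"
    by (simp add: M_eq coords_def)
  have cube': "b * b\<^sup>2 = a0 + a1 * b + a2 * b\<^sup>2"
    using cube(4) by (simp add: power3_eq_cube power2_eq_square mult.assoc)
  \<comment> \<open>Coordinates of the product of an element of \<open>B\<close> with one of
    \<open>M\<close>, after b^3 and b^4 have been reduced by the cubic equation. Every b^2 term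
    carries a factor \<open>c\<close>, and \<open>Z\<close> is what remains when it is removed; this
    divisibility is why \<open>M\<close> is stable under \<open>B\<close>.\<close>
  define X where "X p q s x y z = x * p + y * c\<^sup>2 * s * a0 + z * c * (q * a0 + c * s * a0 * a2)"
    for p q s x y z
  define Y where "Y p q s x y z = x * q + y * c * p + y * c\<^sup>2 * s * a1
      + z * c * (q * a1 + c * s * (a0 + a1 * a2))" for p q s x y z
  define Z where "Z p q s x y z = x * s + y * (q + c * s * a2)
      + z * (p + q * a2 + c * s * (a1 + a2\<^sup>2))" for p q s x y z
  have prod: "(x + y * (c * b) + z * (c * b\<^sup>2)) * coords p q s
      = coords (X p q s x y z) (Y p q s x y z) (Z p q s x y z)" for x y z p q s
  proof -
    have "b * (b * b\<^sup>2) = b * (a0 + a1 * b + a2 * b\<^sup>2)"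
      unfolding cube' ..
    also have "\<dots> = a0 * b + a1 * b\<^sup>2 + a2 * (b * b\<^sup>2)"
      by (simp add: algebra_simps power2_eq_square)
    finally have fourth: "b * (b * b\<^sup>2) = a0 * b + a1 * b\<^sup>2 + a2 * (a0 + a1 * b + a2 * b\<^sup>2)"
      unfolding cube' .
    have "(x + y * (c * b) + z * (c * b\<^sup>2)) * coords p q s
      = x * p + (x * q + y * c * p) * b + (x * s * c + y * c * q + z * c * p) * b\<^sup>2
        + (y * c\<^sup>2 * s + z * c * q) * (b * b\<^sup>2) + z * c\<^sup>2 * s * (b * (b * b\<^sup>2))"
      by (simp add: coords_def algebra_simps power2_eq_square)
    then show ?thesis
      unfolding fourth unfolding cube'
      by (simp add: coords_def X_def Y_def Z_def algebra_simps power2_eq_square)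
  qed
  have XYZ: "X p q s x y z \<in> D" "Y p q s x y z \<in> D" "Z p q s x y z \<in> D"
    if "p \<in> D" "q \<in> D" "s \<in> D" "x \<in> D" "y \<in> D" "z \<in> D" for p q s x y z
    using that unfolding X_def Y_def Z_def by auto
  have add: "coords x y z + coords x' y' z' = coords (x + x') (y + y') (z + z')" for x y z x' y' z'
    by (simp add: coords_def algebra_simps)
  have Madd: "m + m' \<in> M" if "m \<in> M" "m' \<in> M" for m m'
  proof -
    obtain x y z where m: "m = coords x y z" "x \<in> D" "y \<in> D" "z \<in> D"
      using \<open>m \<in> M\<close> unfolding M_coords by blast
    obtain x' y' z' where m': "m' = coords x' y' z'" "x' \<in> D" "y' \<in> D" "z' \<in> D"
      using \<open>m' \<in> M\<close> unfolding M_coords by blast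
    show ?thesis unfolding M_coords m(1) m'(1) add using m(2-4) m'(2-4) D_add by blast
  qed
  have \<phi>_add: "\<phi> (m + m') = \<phi> m + \<phi> m'" if "m \<in> M" "m' \<in> M" for m m'
    using that unfolding M_coords by (auto simp: add \<phi>)
  have BM: "x * m \<in> M" if "x \<in> B" "m \<in> M" for x m
  proof -
    obtain u v w where x: "x = u + v * (c * b) + w * (c * b\<^sup>2)" and D: "u \<in> D" "v \<in> D" "w \<in> D"
      using \<open>x \<in> B\<close> unfolding B_eq by blast
    obtain p q s where m: "m = coords p q s" and D': "p \<in> D" "q \<in> D" "s \<in> D"
      using \<open>m \<in> M\<close> unfolding M_coords by blast
    show ?thesis unfolding x m prod unfolding M_coords using XYZ[OF D' D] by blast
  qed
  have \<phi>_D: "\<phi> m \<in> D" if "m \<in> M" for m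
    using that unfolding M_coords by (auto simp: \<phi>)
  have \<phi>_scale: "\<phi> (d * m) = d * \<phi> m" if "m \<in> M" "d \<in> D" for m d
  proof -
    obtain p q s where m: "m = coords p q s" and D: "p \<in> D" "q \<in> D" "s \<in> D"
      using \<open>m \<in> M\<close> unfolding M_coords by blast
    have "d * m = coords (d * p) (d * q) (d * s)" by (simp add: m coords_def algebra_simps)
    then show ?thesis using D that by (simp add: \<phi> m)
  qed
  have \<phi>_prod: "\<phi> ((x + y * (c * b) + z * (c * b\<^sup>2)) * coords p q s) = Z p q s x y z"
    if "p \<in> D" "q \<in> D" "s \<in> D" "x \<in> D" "y \<in> D" "z \<in> D" for p q s x y z
    unfolding prod using XYZ[OF that] by (rule \<phi>)
  define F where "F m = (\<lambda>x\<in>B. \<phi> (x * m))" for m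
  have FB: "F m x = \<phi> (x * m)" if "x \<in> B" for m x using that by (simp add: F_def)
  have F_dual: "F m \<in> carrier (dual_module D B)" if "m \<in> M" for m
    using DB by (auto simp: dual_module_def F_def BM[OF _ that] \<phi>_D distrib_right \<phi>_add mult.assoc
        \<phi>_scale subset_iff)
  have dualD: "g (x + y * (c * b) + z * (c * b\<^sup>2)) = x * g 1 + y * g (c * b) + z * g (c * b\<^sup>2)"
    if g: "g \<in> carrier (dual_module D B)" and D: "x \<in> D" "y \<in> D" "z \<in> D" for g x y z
  proof -
    have [simp]: "c * b \<in> B" "c * b\<^sup>2 \<in> B" using BI[of 0 1 0] BI[of 0 0 1] by auto
    have g': "\<And>x y. x \<in> B \<Longrightarrow> y \<in> B \<Longrightarrow> g (x + y) = g x + g y"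
      "\<And>d x. d \<in> D \<Longrightarrow> x \<in> B \<Longrightarrow> g (d * x) = d * g x"
      using g by (auto simp: dual_module_def)
    have [simp]: "x \<in> B" "y \<in> B" "z \<in> B" using D DB by auto
    show ?thesis using g'(2)[of x 1] D by (simp add: g')
  qed
  have cbB: "c * b \<in> B" "c * b\<^sup>2 \<in> B" using BI[of 0 1 0] BI[of 0 0 1] by auto
  have basis: "F (coords p q s) 1 = s" "F (coords p q s) (c * b) = q + c * s * a2"
    "F (coords p q s) (c * b\<^sup>2) = p + q * a2 + c * s * (a1 + a2\<^sup>2)"
    if "p \<in> D" "q \<in> D" "s \<in> D" for p q s
    using \<phi>_prod[OF that, of 1 0 0] \<phi>_prod[OF that, of 0 1 0] \<phi>_prod[OF that, of 0 0 1] cbB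
    by (auto simp: FB Z_def)
  have "bij_betw F M (carrier (dual_module D B))"
  proof (rule bij_betw_imageI)
    show "inj_on F M"
    proof (rule inj_onI)
      fix m m' assume "m \<in> M" "m' \<in> M" and eq: "F m = F m'"
      obtain p q s where m: "m = coords p q s" and D: "p \<in> D" "q \<in> D" "s \<in> D"
        using \<open>m \<in> M\<close> unfolding M_coords by blast
      obtain p' q' s' where m': "m' = coords p' q' s'" and D': "p' \<in> D" "q' \<in> D" "s' \<in> D"
        using \<open>m' \<in> M\<close> unfolding M_coords by blast
      have F: "F (coords p q s) = F (coords p' q' s')" using eq by (simp only: m m')
      have "s = s'" by (metis basis(1)[OF D] basis(1)[OF D'] F)
      moreover from this have "q = q'" by (metis add_right_cancel basis(2)[OF D] basis(2)[OF D'] F)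
      moreover from calculation have "p = p'"
        by (metis add_right_cancel basis(3)[OF D] basis(3)[OF D'] F)
      ultimately show "m = m'" by (simp add: m m')
    qed
    show "F ` M = carrier (dual_module D B)"
    proof
      show "F ` M \<subseteq> carrier (dual_module D B)" using F_dual by blast
      show "carrier (dual_module D B) \<subseteq> F ` M"
      proof
        fix g assume g: "g \<in> carrier (dual_module D B)"
        then have gD: "g x \<in> D" if "x \<in> B" for x using that by (auto simp: dual_module_def)
        \<comment> \<open>On 1, c b, c b^2 the functional \<open>F (coords p q s)\<close> takes
          values involving s alone, then q and s, then all three. The coordinates of a preimage of
          \<open>g\<close> are solved for in this order.\<close>
        define s where "s = g 1"
        define q where "q = g (c * b) - c * s * a2"
        define p where "p = g (c * b\<^sup>2) - q * a2 - c * s * (a1 + a2\<^sup>2)"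
        have s: "s \<in> D" using gD[of 1] by (auto simp: s_def)
        have q: "q \<in> D" using gD[OF cbB(1)] s by (auto simp: q_def)
        have p: "p \<in> D" using gD[OF cbB(2)] s q by (auto simp: p_def)
        have M: "coords p q s \<in> M" using p q s by (auto simp: M_coords)
        have "F (coords p q s) x = g x" if "x \<in> B" for x
        proof -
          obtain u v w where x: "x = u + v * (c * b) + w * (c * b\<^sup>2)" and D: "u \<in> D" "v \<in> D" "w \<in> D"
            using \<open>x \<in> B\<close> unfolding B_eq by blast
          have 1: "F (coords p q s) 1 = g 1" "F (coords p q s) (c * b) = g (c * b)"
            "F (coords p q s) (c * b\<^sup>2) = g (c * b\<^sup>2)"
            using basis[OF p q s] by (simp_all add: s_def q_def p_def)
          show ?thesis unfolding x dualD[OF g D] dualD[OF F_dual[OF M] D] 1 ..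
        qed
        then have "F (coords p q s) = g"
          using g F_dual[OF M]
          by (intro extensionalityI[of _ B]) (auto simp: dual_module_def PiE_iff)
        then show "g \<in> F ` M" using M by blast
      qed
    qed
  qed
  moreover have "F (m + m') = (\<lambda>x\<in>B. F m x + F m' x)" if "m \<in> M" "m' \<in> M" for m m'
    by (auto simp: F_def fun_eq_iff distrib_left \<phi>_add BM that)
  moreover have "F (r * m) = (\<lambda>x\<in>B. F m (r * x))" if "r \<in> B" for r m
    using that by (auto simp: F_def fun_eq_iff mult_ac)
  ultimately have "module_isomorphic (ring_on 1 B) (module_on M) (dual_module D B)"
    unfolding module_isomorphic_def
    using module_dual_module[OF D B DB] module_module_on[OF B _ Madd BM] MI[of 0 0 0]
    by (auto simp: module_on_def dual_module_def intro!: exI[of _ F])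
  then show ?thesis
    unfolding dual_isomorphic_to_def by (rule module_isomorphic_sym)
qed

section \<open>The discrete valuation ring and its integral closure\<close>

lemma unique_maximal_idealD:
  assumes "unique_maximal_ideal R P"
  shows "maximalideal P R" "maximalideal J R \<Longrightarrow> J = P"
  using assms by (auto simp: unique_maximal_ideal_def)

lemma unique_maximal_ideal_prime:
  assumes cring: "cring R" and P: "unique_maximal_ideal R P"
    and "x \<in> carrier R" "y \<in> carrier R" "x \<otimes>\<^bsub>R\<^esub> y \<in> P"
  shows "x \<in> P \<or> y \<in> P"
  using primeideal.I_prime[OF cring.maximalideal_prime[OF cring unique_maximal_idealD(1)[OF P]]] assms(3-5) .

lemma unique_maximal_ideal_one_notin:
  assumes "unique_maximal_ideal R P"
  shows "\<one>\<^bsub>R\<^esub> \<notin> P"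
proof
  interpret maximalideal P R by (rule unique_maximal_idealD(1)[OF assms])
  assume "\<one>\<^bsub>R\<^esub> \<in> P"
  then show False using one_imp_carrier I_notcarr by simp
qed

lemma elt_times_closed:
  fixes S :: "'a::comm_ring_1 set"
  shows elt_times_add: "(\<And>x y. x \<in> S \<Longrightarrow> y \<in> S \<Longrightarrow> x + y \<in> S) \<Longrightarrow>
      a \<in> c *o S \<Longrightarrow> b \<in> c *o S \<Longrightarrow> a + b \<in> c *o S"
    and elt_times_diff: "(\<And>x y. x \<in> S \<Longrightarrow> y \<in> S \<Longrightarrow> x - y \<in> S) \<Longrightarrow>
      a \<in> c *o S \<Longrightarrow> b \<in> c *o S \<Longrightarrow> a - b \<in> c *o S"
    and elt_times_scale: "(\<And>x. x \<in> S \<Longrightarrow> d * x \<in> S) \<Longrightarrow> a \<in> c *o S \<Longrightarrow> d * a \<in> c *o S"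
proof -
  assume a: "a \<in> c *o S"
  then obtain x where x: "x \<in> S" "a = c * x" unfolding mem_elt_times by blast
  {
    assume "b \<in> c *o S"
    then obtain y where y: "y \<in> S" "b = c * y" unfolding mem_elt_times by blast
    show "a + b \<in> c *o S" if "\<And>x y. x \<in> S \<Longrightarrow> y \<in> S \<Longrightarrow> x + y \<in> S"
      using set_times_intro2[OF that[OF x(1) y(1)], of c] by (simp add: x y distrib_left)
    show "a - b \<in> c *o S" if "\<And>x y. x \<in> S \<Longrightarrow> y \<in> S \<Longrightarrow> x - y \<in> S"
      using set_times_intro2[OF that[OF x(1) y(1)], of c] by (simp add: x y right_diff_distrib)
  }
  show "d * a \<in> c *o S" if "\<And>x. x \<in> S \<Longrightarrow> d * x \<in> S"
    using set_times_intro2[OF that[OF x(1)], of c] by (simp add: x mult.left_commute[of c])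
qed

lemma mem_add_times: "x \<in> S + c *o T \<longleftrightarrow> (\<exists>y\<in>S. \<exists>z\<in>T. x = y + c * z)"
  by (auto simp: set_plus_def elt_set_times_def)

lemma mem_add_times2:
  "x \<in> S + b *o T + c *o U \<longleftrightarrow> (\<exists>y\<in>S. \<exists>z\<in>T. \<exists>w\<in>U. x = y + b * z + c * w)"
  by (auto simp: set_plus_def elt_set_times_def)

context cubic_setting
begin

section \<open>Cancellation, units and separatedness of \<open>D\<close>\<close>

lemmas D_closed [simp] = subring_whole_ringD[OF D_subring]

lemma K_subring: "subring K whole_ring"
  using subfieldE(1)[OF K_subfield] .

lemmas K_closed = subring_whole_ringD[OF K_subring]

lemma D_subset_K: "D \<subseteq> K"
  using K_fractions by (simp add: field_of_fractions_def)

lemma K_inverse: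
  assumes "x \<in> K" "x \<noteq> 0"
  obtains y where "y \<in> K" "x * y = 1"
proof -
  have "x \<in> Units (whole_ring\<lparr>carrier := K\<rparr>)"
    using subfield.subfield_Units[OF K_subfield] assms by simp
  then show thesis using that by (auto simp: Units_def ring_on_def)
qed

text \<open>\<open>L\<close> may have zero divisors, but a non-zero element of \<open>K\<close> is
  invertible in \<open>L\<close> and hence cancels against arbitrary elements of
  \<open>L\<close>.\<close>

lemma K_cancel:
  assumes "x \<in> K" "x \<noteq> 0" "x * z = 0"
  shows "z = 0"
proof -
  obtain y where "x * y = 1" using K_inverse[OF assms(1,2)] .
  then have "z = y * (x * z)" by (simp add: mult.commute[of x y] flip: mult.assoc)
  then show ?thesis using assms by simp
qed

lemma D_cancel: "x \<in> D \<Longrightarrow> x \<noteq> 0 \<Longrightarrow> x * z = 0 \<Longrightarrow> z = 0"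
  using K_cancel D_subset_K by blast

lemma t_D [simp]: "t \<in> D"
  and D_principal: "principal_domain (ring_on 1 D)"
  and D_not_field: "\<not> field (ring_on 1 D)"
  and D_local: "unique_maximal_ideal (ring_on 1 D) (t *o D)"
  using D_complete_dvr by (auto simp: complete_dvr_def)

lemma cring_D: "cring (ring_on 1 D)"
  by (rule cring_ring_on_subring[OF D_subring])

text \<open>Otherwise the zero ideal would be maximal and \<open>D\<close> would be a field.\<close>

lemma t_nonzero: "t \<noteq> 0"
proof
  interpret D: cring "ring_on 1 D" by (rule cring_D)
  assume "t = 0"
  then have "t *o D = {0}" using zero_mem_elt_times[OF D_closed(1), of t] by (auto simp: mem_elt_times)
  then have "field (ring_on 1 D)"
    using unique_maximal_idealD(1)[OF D_local] D.zeromaximalideal_fieldI by simp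
  then show False using D_not_field by simp
qed

lemma t_cancel: "t ^ n * x = t ^ n * y \<longleftrightarrow> x = y"
proof (induction n arbitrary: x y)
  case (Suc n)
  have "x = y" if "t * x = t * y" for x y
    using D_cancel[OF t_D t_nonzero, of "x - y"] that by (simp add: right_diff_distrib)
  with Suc show ?case by (auto simp: mult.assoc)
qed simp

lemma one_notin_tD: "1 \<notin> t *o D"
  using unique_maximal_ideal_one_notin[OF D_local] by simp

text \<open>A non-zero non-unit has an irreducible divisor, which generates a maximal ideal because
  \<open>D\<close> is principal; the only maximal ideal is t D, so the element would lie in
  it.\<close>

lemma D_unit:
  assumes "x \<in> D" "x \<notin> t *o D"
  obtains y where "y \<in> D" "x * y = 1"
proof (cases "x \<in> Units (ring_on 1 D)")
  case True
  then show ?thesis using that by (auto simp: Units_def)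
next
  case False
  interpret D: principal_domain "ring_on 1 D" by (rule D_principal)
  have "0 \<in> t *o D" by (simp add: zero_mem_elt_times)
  with assms have "x \<noteq> 0" by auto
  then have "x \<in> carrier (ring_on 1 D) - {\<zero>\<^bsub>ring_on 1 D\<^esub>}" using assms(1) by simp
  then obtain p where p: "p \<in> D" "ring_irreducible\<^bsub>ring_on 1 D\<^esub> p" "p divides\<^bsub>ring_on 1 D\<^esub> x"
    using D.exists_irreducible_divisor[OF _ False] unfolding ring_on_simps by metis
  have "PIdl\<^bsub>ring_on 1 D\<^esub> p = t *o D"
    using D.irreducible_imp_maximalideal[of p] p(1,2) unique_maximal_idealD(2)[OF D_local] by simp
  moreover have "x \<in> PIdl\<^bsub>ring_on 1 D\<^esub> p"
    using p(3) unfolding cgenideal_def factor_def by (auto intro: mult.commute)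
  ultimately show ?thesis using assms by simp
qed

lemma tD_prime: "x \<in> D \<Longrightarrow> y \<in> D \<Longrightarrow> x * y \<in> t *o D \<Longrightarrow> x \<in> t *o D \<or> y \<in> t *o D"
  using unique_maximal_ideal_prime[OF cring_D D_local] by auto

lemma tD_power: "x \<in> D \<Longrightarrow> x ^ n \<in> t *o D \<Longrightarrow> x \<in> t *o D"
proof (induction n)
  case 0
  then show ?case using one_notin_tD by simp
next
  case (Suc n)
  then show ?case using tD_prime[of x "x ^ n"] by auto
qed

lemma tD_closed:
  "0 \<in> t *o D" "x \<in> t *o D \<Longrightarrow> y \<in> t *o D \<Longrightarrow> x + y \<in> t *o D"
  "x \<in> t *o D \<Longrightarrow> y \<in> t *o D \<Longrightarrow> x - y \<in> t *o D"
  "d \<in> D \<Longrightarrow> x \<in> t *o D \<Longrightarrow> d * x \<in> t *o D" "x \<in> t *o D \<Longrightarrow> x \<in> D"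
proof -
  show "0 \<in> t *o D" by (simp add: zero_mem_elt_times)
  show "d * x \<in> t *o D" if "d \<in> D" "x \<in> t *o D"
  proof -
    obtain y where "y \<in> D" "x = t * y" using \<open>x \<in> t *o D\<close> unfolding mem_elt_times by blast
    then have "d * y \<in> D" "d * x = t * (d * y)" using \<open>d \<in> D\<close> by (simp_all add: mult_ac)
    then show ?thesis unfolding mem_elt_times by blast
  qed
qed (auto simp: mem_elt_times simp flip: distrib_left right_diff_distrib)

lemma tD_sum: "(\<And>i. i \<in> I \<Longrightarrow> f i \<in> t *o D) \<Longrightarrow> sum f I \<in> t *o D"
  by (induction I rule: infinite_finite_induct) (auto intro: tD_closed)

text \<open>Krull's intersection theorem in a principal domain. The intersection of the ideals t^n D
  has a generator g, and g = t g' with g' again in the intersection, so g' = c g and (1 - t c) g =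
  0; the first factor is non-zero because 1 is not in t D.\<close>

lemma D_separated:
  assumes "x \<in> D" and x: "\<And>n. x \<in> (t ^ n) *o D"
  shows "x = 0"
proof -
  interpret D: principal_domain "ring_on 1 D" by (rule D_principal)
  define I where "I = \<Inter> (range (\<lambda>n. PIdl\<^bsub>ring_on 1 D\<^esub> (t ^ n)))"
  have I_iff: "y \<in> I \<longleftrightarrow> (\<forall>n. \<exists>d\<in>D. y = t ^ n * d)" for y
    by (auto simp: I_def cgenideal_def mult.commute)
  have "ideal I (ring_on 1 D)"
    unfolding I_def by (rule D.i_Intersect) (auto intro!: D.cgenideal_ideal)
  then obtain g where "g \<in> D" and g: "I = PIdl\<^bsub>ring_on 1 D\<^esub> g" using D.exists_gen by auto
  then have "g \<in> I" using D.cgenideal_self[of g] by simp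
  then obtain g' where g': "g' \<in> D" "g = t ^ 1 * g'" unfolding I_iff by blast
  have "g' \<in> I" unfolding I_iff
  proof
    fix n
    obtain d where d: "d \<in> D" "g = t ^ Suc n * d" using \<open>g \<in> I\<close> unfolding I_iff by blast
    then have "t ^ 1 * g' = t ^ 1 * (t ^ n * d)" using g'(2) by (simp add: mult.assoc)
    then show "\<exists>d\<in>D. g' = t ^ n * d" unfolding t_cancel using d by blast
  qed
  then obtain c where c: "c \<in> D" "g' = c * g" using g by (auto simp: cgenideal_def)
  then have "(1 - t * c) * g = 0" using g'(2) by (simp add: left_diff_distrib mult.assoc)
  moreover have "1 - t * c \<noteq> 0" using one_notin_tD c(1) by (auto simp: mem_elt_times)
  ultimately have "g = 0" using c(1) by (intro D_cancel[of "1 - t * c" g]) auto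
  moreover have "x \<in> I" using x unfolding I_iff by (simp add: mem_elt_times)
  ultimately show ?thesis using g by (auto simp: cgenideal_def)
qed

text \<open>Takes out the largest power of t dividing all the d i. It exists by separatedness, since
  one of them is non-zero.\<close>

lemma D_primitive_multiple:
  assumes "finite I" "\<And>i. i \<in> I \<Longrightarrow> d i \<in> D" "i \<in> I" "d i \<noteq> 0"
  obtains n e where "\<And>i. i \<in> I \<Longrightarrow> e i \<in> D" "\<And>i. i \<in> I \<Longrightarrow> d i = t ^ n * e i"
    "\<exists>i\<in>I. e i \<notin> t *o D"
proof -
  define P where "P n \<longleftrightarrow> (\<forall>i\<in>I. d i \<in> (t ^ n) *o D)" for n
  have "\<exists>n. \<not> P n" 
    using D_separated[OF assms(2)[OF assms(3)]] assms(3,4) by (auto simp only: P_def)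
  moreover have "P 0" using assms(2) by (auto simp: P_def mem_elt_times)
  ultimately obtain n where n: "P n" "\<not> P (Suc n)"
    using nat_induct[of P] by blast
  have "\<forall>i\<in>I. \<exists>y. y \<in> D \<and> d i = t ^ n * y" using n(1) unfolding P_def mem_elt_times by blast
  from bchoice[OF this] obtain e where e: "\<And>i. i \<in> I \<Longrightarrow> e i \<in> D \<and> d i = t ^ n * e i"
    by blast
  moreover have "\<exists>i\<in>I. e i \<notin> t *o D"
  proof (rule ccontr)
    assume none: "\<not> ?thesis"
    have "d i \<in> (t ^ Suc n) *o D" if i: "i \<in> I" for i
    proof -
      obtain y where "y \<in> D" "e i = t * y"
        using none i unfolding mem_elt_times by blast
      then have "d i = t ^ Suc n * y" using e[OF i] by (simp add: mult_ac)
      then show ?thesis using \<open>y \<in> D\<close> unfolding mem_elt_times by blast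
    qed
    with n(2) show False by (simp add: P_def)
  qed
  ultimately show thesis using that[of e n] e by blast
qed

section \<open>Linear dependence over \<open>D\<close>\<close>

lemma common_denominator:
  assumes "finite I" "\<And>i. i \<in> I \<Longrightarrow> x i \<in> K"
  obtains c where "c \<in> D" "c \<noteq> 0" "\<And>i. i \<in> I \<Longrightarrow> c * x i \<in> D"
  using assms
proof (induction I arbitrary: thesis rule: finite_induct)
  case empty
  then show ?case using D_closed(2) by (metis empty_iff zero_neq_one)
next
  case (insert j I)
  then obtain c where c: "c \<in> D" "c \<noteq> 0" "\<And>i. i \<in> I \<Longrightarrow> c * x i \<in> D"
    by (metis insert_iff)
  obtain b where b: "b \<in> D" "b \<noteq> 0" "x j * b \<in> D"
    using K_fractions insert.prems(2)[of j] by (auto simp: field_of_fractions_def)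
  show ?case
  proof (rule insert.prems(1)[of "b * c"])
    show "b * c \<noteq> 0" using D_cancel[OF b(1,2)] c(2) by blast
    fix i assume "i \<in> insert j I"
    then show "b * c * x i \<in> D"
      using b(1,3) c(1,3) D_closed(4)[of c "x j * b"] D_closed(4)[of b "c * x i"]
      by (auto simp: mult_ac)
  qed (use b c in auto)
qed

text \<open>Dimension three supplies a non-trivial relation over \<open>K\<close>. Clearing
  denominators moves it into \<open>D\<close>, and dividing by the largest common power of t, which
  cancels in \<open>L\<close>, leaves a coefficient outside of t D.\<close>

lemma four_dependent:
  obtains d1 d2 d3 d4 where "d1 \<in> D" "d2 \<in> D" "d3 \<in> D" "d4 \<in> D"
    "d1 * x1 + d2 * x2 + d3 * x3 + d4 * x4 = 0"
    "d1 \<notin> t *o D \<or> d2 \<notin> t *o D \<or> d3 \<notin> t *o D \<or> d4 \<notin> t *o D"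
proof -
  interpret W: cring "whole_ring :: 'a ring" by (rule cring_whole_ring)
  have "\<not> W.independent K [x1, x2, x3, x4]"
    using W.independent_length_le_dimension[OF K_subfield L_dimension, of "[x1, x2, x3, x4]"] by auto
  then obtain ks where ks: "set ks \<subseteq> K" "W.combine ks [x1, x2, x3, x4] = 0"
    "\<not> set (take 4 ks) \<subseteq> {0}"
    using W.trivial_combine_imp_independent[OF K_subfield, of "[x1, x2, x3, x4]"]
    by (auto simp: numeral_eq_Suc)
  \<comment> \<open>\<open>combine\<close> stops at the end of the shorter list, so
    \<open>ks\<close> may have any length; missing coefficients count as 0.\<close>
  define nth0 where "nth0 ls i = (if i < length ls then ls ! i else 0)" for ls :: "'a list" and i
  have "W.combine ls [x1, x2, x3, x4] = nth0 ls 0 * x1 + nth0 ls 1 * x2 + nth0 ls 2 * x3 + nth0 ls 3 * x4"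
    for ls
    by (cases ls; cases "tl ls"; cases "tl (tl ls)"; cases "tl (tl (tl ls))")
      (auto simp: nth0_def numeral_2_eq_2 numeral_3_eq_3 add.assoc)
  moreover define k where "k = nth0 ks"
  ultimately have rel: "k 0 * x1 + k 1 * x2 + k 2 * x3 + k 3 * x4 = 0" using ks(2) by metis
  have kK: "k i \<in> K" for i using ks(1) K_closed(1) by (auto simp: k_def nth0_def)
  obtain i where i: "i < 4" "k i \<noteq> 0"
  proof -
    obtain y where "y \<in> set (take 4 ks)" "y \<noteq> 0" using ks(3) by auto
    then obtain i where "i < length (take 4 ks)" "take 4 ks ! i = y" by (meson in_set_conv_nth)
    then show thesis using that[of i] \<open>y \<noteq> 0\<close> by (auto simp: k_def nth0_def)
  qed
  obtain c where c: "c \<in> D" "c \<noteq> 0" "\<And>i. i \<in> {..<4::nat} \<Longrightarrow> c * k i \<in> D"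
    using common_denominator[of "{..<4::nat}" k] kK by auto
  have nz: "c * k i \<noteq> 0" using D_cancel[OF c(1,2)] i(2) by blast
  have "i \<in> {..<4}" using i(1) by simp
  from D_primitive_multiple[of "{..<4::nat}" "\<lambda>i. c * k i", OF _ c(3) this nz]
  obtain n e where e: "\<And>i. i \<in> {..<4::nat} \<Longrightarrow> e i \<in> D"
    "\<And>i. i \<in> {..<4::nat} \<Longrightarrow> c * k i = t ^ n * e i" "\<exists>i\<in>{..<4::nat}. e i \<notin> t *o D"
    by (metis finite_lessThan)
  have "t ^ n * (e 0 * x1 + e 1 * x2 + e 2 * x3 + e 3 * x4)
    = c * (k 0 * x1 + k 1 * x2 + k 2 * x3 + k 3 * x4)"
    using e(2)[of 0] e(2)[of 1] e(2)[of 2] e(2)[of 3] by (simp add: distrib_left flip: mult.assoc)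
  then have "e 0 * x1 + e 1 * x2 + e 2 * x3 + e 3 * x4 = 0"
    using t_cancel[of n _ 0] rel by simp
  moreover have "e 0 \<notin> t *o D \<or> e 1 \<notin> t *o D \<or> e 2 \<notin> t *o D \<or> e 3 \<notin> t *o D"
    using e(3) by (auto simp: numeral_eq_Suc less_Suc_eq)
  ultimately show thesis using that e(1)[of 0] e(1)[of 1] e(1)[of 2] e(1)[of 3] by simp
qed

section \<open>The integral closure and idempotents of \<open>L\<close>\<close>

lemma D_subset_A: "D \<subseteq> A"
proof
  fix x assume x: "x \<in> D"
  then have "set (coeffs [:- x, 1:]) \<subseteq> D" by (auto simp: cCons_def)
  then show "x \<in> A"
    unfolding A_def integral_closure_def by (intro CollectI exI[of _ "[:- x, 1:]"]) auto
qed

text \<open>Finite generation presents \<open>A\<close> as the set of all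
  \<open>D\<close>-combinations of a finite set, so sums and scalar multiples need no manipulation
  of integral equations. Closure under products is obtained later, from the ring structure contained
  in the hypothesis on maximal ideals.\<close>

lemma A_closed:
  shows A_zero: "0 \<in> A" and A_one: "1 \<in> A"
    and A_add: "x \<in> A \<Longrightarrow> y \<in> A \<Longrightarrow> x + y \<in> A"
    and A_scale: "d \<in> D \<Longrightarrow> x \<in> A \<Longrightarrow> d * x \<in> A"
    and A_diff: "x \<in> A \<Longrightarrow> y \<in> A \<Longrightarrow> x - y \<in> A"
proof -
  show "0 \<in> A" "1 \<in> A" using D_subset_A by auto
  obtain S where S: "A = {(\<Sum>s\<in>S. c s * s) | c. c \<in> S \<rightarrow> D}"
    using A_fg by (auto simp: fg_module_def)
  show add: "x + y \<in> A" if "x \<in> A" "y \<in> A" for x y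
  proof -
    obtain c where "x = (\<Sum>s\<in>S. c s * s)" "c \<in> S \<rightarrow> D" using \<open>x \<in> A\<close> unfolding S by blast
    moreover obtain c' where "y = (\<Sum>s\<in>S. c' s * s)" "c' \<in> S \<rightarrow> D"
      using \<open>y \<in> A\<close> unfolding S by blast
    ultimately show ?thesis unfolding S
      by (auto simp: Pi_iff distrib_right sum.distrib intro!: exI[of _ "\<lambda>s. c s + c' s"])
  qed
  show scale: "d * x \<in> A" if "d \<in> D" "x \<in> A" for d x
  proof -
    obtain c where "x = (\<Sum>s\<in>S. c s * s)" "c \<in> S \<rightarrow> D"
      using \<open>x \<in> A\<close> unfolding S by blast
    then show ?thesis unfolding S using that
      by (auto simp: Pi_iff sum_distrib_left mult.assoc intro!: exI[of _ "\<lambda>s. d * c s"])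
  qed
  have minus: "- x \<in> A" if "x \<in> A" for x using scale[of "- 1" x] that by simp
  show "x - y \<in> A" if "x \<in> A" "y \<in> A" using add[OF that(1) minus[OF that(2)]] by simp
qed

text \<open>Since f absorbs its own powers, f p(f x) = f p(x). Hence if the monic p annihilates x,
  then X p annihilates f x; the extra factor X supplies the f in front. With x = 1 this shows that
  every idempotent of \<open>L\<close> lies in \<open>A\<close>.\<close>

lemma idempotent_mult_A:
  assumes f: "f * f = f" and x: "x \<in> A"
  shows "f * x \<in> A"
proof -
  obtain p where p: "lead_coeff p = 1" "set (coeffs p) \<subseteq> D" "poly p x = 0"
    using x by (auto simp: A_def integral_closure_def)
  have transport: "f * poly q (f * x) = f * poly q x" for q
  proof (induction q)
    case (pCons a q)
    have "f * poly (pCons a q) (f * x) = f * a + x * (f * (f * poly q (f * x)))"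
      by (simp add: algebra_simps)
    also have "\<dots> = f * a + x * ((f * f) * poly q x)" by (simp only: pCons mult.assoc)
    also have "\<dots> = f * a + x * (f * poly q x)" by (simp only: f)
    also have "\<dots> = f * poly (pCons a q) x" by (simp add: algebra_simps)
    finally show ?case .
  qed simp
  have "poly (pCons 0 p) (f * x) = x * (f * poly p (f * x))"
    by (simp add: mult_ac)
  also have "\<dots> = x * (f * poly p x)" by (simp only: transport)
  finally have "poly (pCons 0 p) (f * x) = 0" using p by simp
  moreover have "p \<noteq> 0" using p by auto
  then have "lead_coeff (pCons 0 p) = 1" "set (coeffs (pCons 0 p)) \<subseteq> D"
    using p by (auto simp: cCons_def)
  ultimately show ?thesis unfolding A_def integral_closure_def by blast
qed

text \<open>
  If \<open>f d = t a\<close>, an integral equation of degree \<open>n\<close> of \<open>a\<close>, multiplied by \<open>t\<^sup>n f\<close>, becomes \<open>f w = 0\<close>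
  with \<open>w \<equiv> d\<^sup>n\<close> modulo \<open>t D\<close>.
\<close>

lemma idempotent_mult_in_tA:
  assumes f: "f * f = f" "f \<noteq> 0" and d: "d \<in> D" "f * d \<in> t *o A"
  shows "d \<in> t *o D"
proof (rule ccontr)
  assume nd: "d \<notin> t *o D"
  obtain a where a: "a \<in> A" "f * d = t * a" using d by (auto simp: mem_elt_times)
  obtain p where p: "lead_coeff p = 1" "set (coeffs p) \<subseteq> D" "poly p a = 0"
    using a(1) by (auto simp: A_def integral_closure_def)
  have coeff_D: "coeff p i \<in> D" for i
    using p(2) D_closed(1) coeff_in_coeffs[of p i] by (cases "p = 0 \<or> i > degree p") (auto simp: coeff_eq_0)
  define n where "n = degree p"
  define w where "w = (\<Sum>i\<le>n. coeff p i * t ^ (n - i) * d ^ i)"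
  have f_power: "f * (f * d) ^ i = f * d ^ i" for i
  proof (induction i)
    case (Suc i)
    have "f * (f * d) ^ Suc i = d * ((f * f) * (f * d) ^ i)" by (simp add: mult_ac)
    also have "\<dots> = d * (f * d ^ i)" by (simp only: f Suc)
    finally show ?case by (simp add: mult_ac)
  qed simp
  have "f * w = (\<Sum>i\<le>n. coeff p i * t ^ (n - i) * (f * (f * d) ^ i))"
    unfolding f_power by (simp add: w_def sum_distrib_left mult_ac)
  also have "\<dots> = (\<Sum>i\<le>n. f * t ^ n * (coeff p i * a ^ i))"
  proof (rule sum.cong)
    fix i assume "i \<in> {..n}"
    then have "t ^ n = t ^ (n - i) * t ^ i" by (simp flip: power_add)
    moreover have "(f * d) ^ i = t ^ i * a ^ i" by (simp only: a(2) power_mult_distrib)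
    ultimately show "coeff p i * t ^ (n - i) * (f * (f * d) ^ i) = f * t ^ n * (coeff p i * a ^ i)"
      by (simp add: mult_ac)
  qed simp
  also have "\<dots> = f * t ^ n * poly p a" by (simp add: poly_altdef sum_distrib_left n_def)
  finally have fw: "w * f = 0" using p(3) by (simp add: mult.commute)
  \<comment> \<open>Only the leading term is free of t, and its coefficient is 1.\<close>
  have "w = (\<Sum>i<n. coeff p i * t ^ (n - i) * d ^ i) + d ^ n"
    using p(1) by (simp add: w_def n_def lessThan_Suc_atMost[symmetric])
  moreover have "(\<Sum>i<n. coeff p i * t ^ (n - i) * d ^ i) \<in> t *o D"
  proof (rule tD_sum)
    fix i assume "i \<in> {..<n}"
    then have "t ^ (n - i) = t * t ^ (n - Suc i)" by (simp flip: power_Suc add: Suc_diff_Suc)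
    then have "coeff p i * t ^ (n - i) * d ^ i = t * (coeff p i * t ^ (n - Suc i) * d ^ i)"
      by (simp add: mult_ac)
    moreover have "coeff p i * t ^ (n - Suc i) * d ^ i \<in> D" using coeff_D d by simp
    ultimately show "coeff p i * t ^ (n - i) * d ^ i \<in> t *o D"
      unfolding mem_elt_times by blast
  qed
  moreover have "d ^ n \<notin> t *o D" using tD_power nd d by blast
  ultimately have "w \<notin> t *o D"
    using tD_closed(3)[of w "\<Sum>i<n. coeff p i * t ^ (n - i) * d ^ i"] by auto
  then have "w \<noteq> 0" using tD_closed(1) by auto
  moreover have "w \<in> D"
    unfolding \<open>w = _ + _\<close> using d by (intro D_closed(5) tD_closed(5)[OF \<open>sum _ _ \<in> t *o D\<close>]) simp
  \<comment> \<open>A non-zero element of \<open>D\<close> is invertible in \<open>L\<close> and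
    cannot annihilate f.\<close>
  ultimately show False using D_cancel fw f(2) by blast
qed

section \<open>Bases of \<open>A\<close> from independence modulo t\<close>

lemma basis_A:
  assumes n: "n1 \<in> A" "n2 \<in> A" "n3 \<in> A"
    and indep: "\<And>d1 d2 d3. d1 \<in> D \<Longrightarrow> d2 \<in> D \<Longrightarrow> d3 \<in> D \<Longrightarrow>
      d1 * n1 + d2 * n2 + d3 * n3 \<in> t *o A \<Longrightarrow> d1 \<in> t *o D \<and> d2 \<in> t *o D \<and> d3 \<in> t *o D"
  shows basis_A_span: "x \<in> A \<Longrightarrow> \<exists>d1\<in>D. \<exists>d2\<in>D. \<exists>d3\<in>D. x = d1 * n1 + d2 * n2 + d3 * n3"
    and basis_A_indep: "d1 \<in> D \<Longrightarrow> d2 \<in> D \<Longrightarrow> d3 \<in> D \<Longrightarrow> d1 * n1 + d2 * n2 + d3 * n3 = 0 \<Longrightarrow>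
      d1 = 0 \<and> d2 = 0 \<and> d3 = 0"
proof -
  assume x: "x \<in> A"
  obtain c d1 d2 d3 where D: "c \<in> D" "d1 \<in> D" "d2 \<in> D" "d3 \<in> D"
    and rel: "c * x + d1 * n1 + d2 * n2 + d3 * n3 = 0"
    and unit: "c \<notin> t *o D \<or> d1 \<notin> t *o D \<or> d2 \<notin> t *o D \<or> d3 \<notin> t *o D"
    using four_dependent[of x n1 n2 n3] .
  \<comment> \<open>If c were divisible by t, the other three terms would sum to an element of t A,
    and independence would put all four coefficients into t D.\<close>
  have "c \<notin> t *o D"
  proof
    assume c: "c \<in> t *o D"
    then obtain c' where c': "c' \<in> D" "c = t * c'" by (auto simp: mem_elt_times)
    have "d1 * n1 + d2 * n2 + d3 * n3 = - (c * x)" using rel by (simp add: algebra_simps eq_neg_iff_add_eq_0)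
    also have "\<dots> = t * (- c' * x)" by (simp add: c' mult.assoc)
    also have "\<dots> \<in> t *o A" using c'(1) by (intro set_times_intro2 A_scale x) simp
    finally have "d1 * n1 + d2 * n2 + d3 * n3 \<in> t *o A" .
    then show False using indep[OF D(2-4)] c unit by blast
  qed
  then obtain u where u: "u \<in> D" "c * u = 1" using D_unit D(1) by blast
  have "x = (c * u) * x" using u by simp
  also have "\<dots> = u * (c * x + d1 * n1 + d2 * n2 + d3 * n3)
      + (- u * d1) * n1 + (- u * d2) * n2 + (- u * d3) * n3" by (simp add: algebra_simps)
  also have "\<dots> = (- u * d1) * n1 + (- u * d2) * n2 + (- u * d3) * n3" by (simp add: rel)
  finally show "\<exists>d1\<in>D. \<exists>d2\<in>D. \<exists>d3\<in>D. x = d1 * n1 + d2 * n2 + d3 * n3"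
    using u(1) D by (intro bexI[of _ "- u * d1"] bexI[of _ "- u * d2"] bexI[of _ "- u * d3"]) simp_all
next
  \<comment> \<open>Descent: the coefficients of a relation are divisible by t, and cancelling t
    gives another relation. So they are divisible by every power of t and vanish by
    separatedness.\<close>
  have "\<forall>d1\<in>D. \<forall>d2\<in>D. \<forall>d3\<in>D. d1 * n1 + d2 * n2 + d3 * n3 = 0 \<longrightarrow>
     d1 \<in> (t ^ k) *o D \<and> d2 \<in> (t ^ k) *o D \<and> d3 \<in> (t ^ k) *o D" for k
  proof (induction k)
    case 0
    then show ?case by (simp add: mem_elt_times)
  next
    case (Suc k)
    show ?case
    proof (intro ballI impI)
      fix d1 d2 d3 assume D: "d1 \<in> D" "d2 \<in> D" "d3 \<in> D" and rel: "d1 * n1 + d2 * n2 + d3 * n3 = 0"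
      then have "d1 * n1 + d2 * n2 + d3 * n3 \<in> t *o A" by (simp add: zero_mem_elt_times A_zero)
      then obtain e1 e2 e3 where e: "e1 \<in> D" "e2 \<in> D" "e3 \<in> D" "d1 = t * e1" "d2 = t * e2" "d3 = t * e3"
        using indep[OF D] by (auto simp: mem_elt_times)
      then have "t ^ 1 * (e1 * n1 + e2 * n2 + e3 * n3) = t ^ 1 * 0"
        using rel by (simp add: distrib_left mult.assoc)
      then have "e1 * n1 + e2 * n2 + e3 * n3 = 0" unfolding t_cancel .
      then have "e1 \<in> (t ^ k) *o D \<and> e2 \<in> (t ^ k) *o D \<and> e3 \<in> (t ^ k) *o D" using Suc e by blast
      then show "d1 \<in> (t ^ Suc k) *o D \<and> d2 \<in> (t ^ Suc k) *o D \<and> d3 \<in> (t ^ Suc k) *o D"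
        unfolding e by (auto simp: mem_elt_times mult.assoc)
    qed
  qed
  moreover assume "d1 \<in> D" "d2 \<in> D" "d3 \<in> D" "d1 * n1 + d2 * n2 + d3 * n3 = 0"
  ultimately show "d1 = 0 \<and> d2 = 0 \<and> d3 = 0" using D_separated by blast
qed

text \<open>
  With \<open>b = t\<^sup>s \<nu>\<close>, the hypotheses say that \<open>D + b D + t\<^sup>m A = D[b]\<close>.
\<close>

lemma dual_isomorphic_to_of_basis:
  fixes k s m :: nat
  assumes A: "\<nu> \<in> A" "\<delta> \<in> A" "\<nu> * \<delta> \<in> A"
    and indep: "\<And>d1 d2 d3. d1 \<in> D \<Longrightarrow> d2 \<in> D \<Longrightarrow> d3 \<in> D \<Longrightarrow>
      d1 + d2 * \<nu> + d3 * \<delta> \<in> t *o A \<Longrightarrow> d1 \<in> t *o D \<and> d2 \<in> t *o D \<and> d3 \<in> t *o D"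
    and sm: "s \<le> m" and d: "d \<in> D" and square: "(t ^ s * \<nu>)\<^sup>2 = d * (t ^ s * \<nu>) + t ^ m * \<delta>"
    and cubic: "cubic_ring D B"
    and B: "B = D + (t ^ k) *o (D + (t ^ s * \<nu>) *o D + (t ^ m) *o A)"
  shows "dual_isomorphic_to D B (D + (t ^ s * \<nu>) *o D + (t ^ (k + m)) *o A)"
proof -
  define b where "b = t ^ s * \<nu>"
  have square: "b\<^sup>2 = d * b + t ^ m * \<delta>" using square by (simp add: b_def)
  have indep: "d1 \<in> D \<Longrightarrow> d2 \<in> D \<Longrightarrow> d3 \<in> D \<Longrightarrow> d1 * 1 + d2 * \<nu> + d3 * \<delta> \<in> t *o A \<Longrightarrow>
      d1 \<in> t *o D \<and> d2 \<in> t *o D \<and> d3 \<in> t *o D" for d1 d2 d3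
    using indep[of d1 d2 d3] by simp
  note span = basis_A_span[OF A_one A(1,2) indep]
  \<comment> \<open>This is where s \<le> m enters: the \<nu>-part of t^(i + m) A is absorbed by b
    D.\<close>
  have t_b: "t ^ (i + m) * \<nu> = t ^ (i + (m - s)) * b" for i
    using sm by (simp add: b_def flip: mult.assoc power_add)
  \<comment> \<open>One computation for two modules: i = 0 gives the ring C and i = k the claimed
    dual.\<close>
  have M: "D + b *o D + (t ^ (i + m)) *o A
      = {x + y * b + z * (t ^ i * b\<^sup>2) | x y z. x \<in> D \<and> y \<in> D \<and> z \<in> D}" (is "?L = ?R") for i
  proof (intro equalityI subsetI)
    fix w assume "w \<in> ?L"
    then obtain x y a where w: "w = x + b * y + t ^ (i + m) * a" and D: "x \<in> D" "y \<in> D" and "a \<in> A"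
      unfolding mem_add_times2 by blast
    obtain e1 e2 e3 where a: "a = e1 * 1 + e2 * \<nu> + e3 * \<delta>" and e: "e1 \<in> D" "e2 \<in> D" "e3 \<in> D"
      using span[OF _ _ _ _ \<open>a \<in> A\<close>] by blast
    have "t ^ (i + m) * a = t ^ (i + m) * e1 + e2 * (t ^ (i + m) * \<nu>) + e3 * t ^ i * (t ^ m * \<delta>)"
      by (simp add: a algebra_simps power_add)
    also have "\<dots> = t ^ (i + m) * e1 + (e2 * t ^ (i + (m - s)) - e3 * t ^ i * d) * b + e3 * (t ^ i * b\<^sup>2)"
      unfolding t_b square by (simp add: algebra_simps)
    finally have "w = (x + t ^ (i + m) * e1) + (y + (e2 * t ^ (i + (m - s)) - e3 * t ^ i * d)) * b
        + e3 * (t ^ i * b\<^sup>2)"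
      by (simp add: w algebra_simps)
    moreover have "x + t ^ (i + m) * e1 \<in> D" "y + (e2 * t ^ (i + (m - s)) - e3 * t ^ i * d) \<in> D"
      using D e d by simp_all
    ultimately show "w \<in> ?R" using e(3) by blast
  next
    fix w assume "w \<in> ?R"
    then obtain x y z where w: "w = x + y * b + z * (t ^ i * b\<^sup>2)" and D: "x \<in> D" "y \<in> D" "z \<in> D"
      by blast
    have "w = x + b * (y + z * t ^ i * d) + t ^ (i + m) * (z * \<delta>)"
      unfolding w square by (simp add: algebra_simps power_add)
    moreover have "y + z * t ^ i * d \<in> D" "z * \<delta> \<in> A" using D d A_scale A(2) by simp_all
    ultimately show "w \<in> ?L" using D(1) unfolding mem_add_times2 by blast
  qed
  have C: "D + b *o D + (t ^ m) *o A = {x + y * b + z * b\<^sup>2 | x y z. x \<in> D \<and> y \<in> D \<and> z \<in> D}"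
    using M[of 0] by simp
  \<comment> \<open>Source of the cubic equation of b: the product of b with t^m \<delta> is in t^m
    A because \<nu> \<delta> is in \<open>A\<close>, hence in C, so it expands in 1, b, b^2 with
    coefficients in \<open>D\<close>.\<close>
  have "b * (t ^ m * \<delta>) = 0 + b * 0 + t ^ m * (t ^ s * (\<nu> * \<delta>))" by (simp add: b_def algebra_simps)
  moreover have "t ^ s * (\<nu> * \<delta>) \<in> A" using A(3) A_scale by simp
  ultimately have "b * (t ^ m * \<delta>) \<in> D + b *o D + (t ^ m) *o A"
    unfolding mem_add_times2 using D_closed(1) by blast
  then obtain x y z where D: "x \<in> D" "y \<in> D" "z \<in> D" and b\<delta>: "b * (t ^ m * \<delta>) = x + y * b + z * b\<^sup>2"
    unfolding C by blast
  have "b ^ 3 = d * b\<^sup>2 + b * (t ^ m * \<delta>)"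
    using arg_cong[OF square, of "\<lambda>x. b * x"]
    by (simp add: power3_eq_cube power2_eq_square algebra_simps)
  then have cube: "b ^ 3 = x + y * b + (z + d) * b\<^sup>2" unfolding b\<delta> by (simp add: algebra_simps)
  have "dual_isomorphic_to D B (D + b *o D + (t ^ (k + m)) *o A)"
  proof (rule dual_isomorphic_to_monogenic[OF D_subring _ _ _ _ D(1,2) _ cube _ M])
    show "subring B whole_ring" using cubic by (simp add: cubic_ring_def)
    show "w = 0" if "t ^ k * w = 0" for w using t_cancel[of k w 0] that by simp
    show "x' = 0 \<and> y' = 0 \<and> z' = 0"
      if "x' \<in> D" "y' \<in> D" "z' \<in> D" and eq: "x' + y' * b + z' * b\<^sup>2 = 0" for x' y' z'
    proof -
      have "x' * 1 + (t ^ s * (y' + z' * d)) * \<nu> + (t ^ m * z') * \<delta> = 0"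
        using eq unfolding square by (simp add: b_def algebra_simps)
      with that d basis_A_indep[OF A_one A(1,2) indep, of x' "t ^ s * (y' + z' * d)" "t ^ m * z'"]
      have "x' = 0" "t ^ s * (y' + z' * d) = 0" "t ^ m * z' = 0" by auto
      then show ?thesis using t_cancel[of s "y' + z' * d" 0] t_cancel[of m z' 0] by simp
    qed
    show "B = {x + y * (t ^ k * b) + z * (t ^ k * b\<^sup>2) | x y z. x \<in> D \<and> y \<in> D \<and> z \<in> D}" (is "_ = ?R")
      unfolding B b_def[symmetric] C
    proof (intro equalityI subsetI)
      fix w assume "w \<in> D + (t ^ k) *o {x + y * b + z * b\<^sup>2 | x y z. x \<in> D \<and> y \<in> D \<and> z \<in> D}"
      then obtain v x' y' z' where w: "w = v + t ^ k * (x' + y' * b + z' * b\<^sup>2)"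
        and D: "v \<in> D" "x' \<in> D" "y' \<in> D" "z' \<in> D"
        unfolding mem_add_times by blast
      have "w = (v + t ^ k * x') + y' * (t ^ k * b) + z' * (t ^ k * b\<^sup>2)" by (simp add: w algebra_simps)
      moreover have "v + t ^ k * x' \<in> D" using D by simp
      ultimately show "w \<in> ?R" using D by blast
    next
      fix w assume "w \<in> ?R"
      then obtain x' y' z' where w: "w = x' + y' * (t ^ k * b) + z' * (t ^ k * b\<^sup>2)"
        and D: "x' \<in> D" "y' \<in> D" "z' \<in> D" by blast
      have "w = x' + t ^ k * (0 + y' * b + z' * b\<^sup>2)" by (simp add: w algebra_simps)
      then show "w \<in> D + (t ^ k) *o {x + y * b + z * b\<^sup>2 | x y z. x \<in> D \<and> y \<in> D \<and> z \<in> D}"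
        unfolding mem_add_times using D D_closed(1) by blast
    qed
  qed (use D d in simp_all)
  then show ?thesis by (simp add: b_def)
qed

end

section \<open>Local factors of the integral closure\<close>

lemma ring_ring_on_imp_cring:
  assumes "ring (ring_on u S)"
  shows "cring (ring_on u S)"
proof -
  interpret R: ring "ring_on u S" by fact
  have "comm_monoid (ring_on u S)"
    by (rule R.monoid_comm_monoidI) (simp add: mult.commute)
  then show ?thesis using assms by (simp add: cring_def)
qed

text \<open>A common frame for the first four cases, with n the ramification index. When
  \<open>L\<close> is a field, e = 1 and S = A; with two branches, S is the factor D1. The
  unramified cases are included by \<tau> = t and n = 1.\<close>

locale local_factor = cubic_setting K D A t
  for K D A :: "'a::comm_ring_1 set" and t :: 'a +
  fixes e :: 'a and S :: "'a set" and \<tau> :: 'a and n :: nat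
  assumes e_idem: "e * e = e"
    and S_def: "S = e *o A"
    and S_local: "unique_maximal_ideal (ring_on e S) (\<tau> *o S)"
    and t_tau: "t *o S = (\<tau> ^ n) *o S"
    and n_pos: "0 < n"
begin

section \<open>The factor \<open>S\<close> and its filtration by powers of \<tau>\<close>

lemma S_iff: "x \<in> S \<longleftrightarrow> x \<in> A \<and> e * x = x"
proof
  assume "x \<in> S"
  then obtain a where "a \<in> A" "x = e * a" unfolding S_def mem_elt_times by blast
  then show "x \<in> A \<and> e * x = x" using idempotent_mult_A[OF e_idem] e_idem by (simp flip: mult.assoc)
next
  assume "x \<in> A \<and> e * x = x"
  then show "x \<in> S" using set_times_intro2[of x A e] by (simp add: S_def)
qed

lemma S_ideal: "ideal (\<tau> *o S) (ring_on e S)"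
  using maximalideal.axioms(1)[OF unique_maximal_idealD(1)[OF S_local]] .

text \<open>A maximal ideal is in particular an ideal, and that predicate already contains the ring
  axioms of its ambient ring. This is the source of closure under products.\<close>

lemma cring_S: "cring (ring_on e S)"
  using ring_ring_on_imp_cring[OF ideal.axioms(2)[OF S_ideal]] .

lemma S_closed [simp]:
  "0 \<in> S" "e \<in> S" "x \<in> S \<Longrightarrow> y \<in> S \<Longrightarrow> x + y \<in> S" "x \<in> S \<Longrightarrow> y \<in> S \<Longrightarrow> x - y \<in> S"
  "x \<in> S \<Longrightarrow> y \<in> S \<Longrightarrow> x * y \<in> S" "d \<in> D \<Longrightarrow> x \<in> S \<Longrightarrow> d * x \<in> S"
proof -
  interpret S: cring "ring_on e S" by (rule cring_S)
  show "0 \<in> S" "e \<in> S" using S.zero_closed S.one_closed by simp_all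
  show "x + y \<in> S" if "x \<in> S" "y \<in> S" using S.add.m_closed[of x y] that by simp
  show "x * y \<in> S" if "x \<in> S" "y \<in> S" using S.m_closed[of x y] that by simp
  show "x - y \<in> S" if "x \<in> S" "y \<in> S"
    using that by (simp add: S_iff A_diff right_diff_distrib)
  show "d * x \<in> S" if "d \<in> D" "x \<in> S"
    using that by (simp add: S_iff A_scale mult.left_commute[of e])
qed

text \<open>In the unramified case with two branches \<tau> is t, which is not an element of e L. So
  membership is derived from the inclusion of the ideal \<open>\<tau> *o S\<close> in
  \<open>S\<close>, and powers of \<tau> always act on elements of \<open>S\<close>.\<close>

lemma tau_closed: "x \<in> S \<Longrightarrow> \<tau> ^ k * x \<in> S"
proof (induction k)
  case (Suc k)
  have "\<tau> *o S \<subseteq> S"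
    using additive_subgroup.a_subset[OF ideal.axioms(1)[OF S_ideal]] by simp
  then have "\<tau> * (\<tau> ^ k * x) \<in> S" using Suc set_times_intro2[of "\<tau> ^ k * x" S \<tau>] by blast
  then show ?case by (simp add: mult.assoc)
qed simp

lemma tau_add: "x \<in> (\<tau> ^ k) *o S \<Longrightarrow> y \<in> (\<tau> ^ k) *o S \<Longrightarrow> x + y \<in> (\<tau> ^ k) *o S"
  by (rule elt_times_add) simp_all

lemma tau_diff: "x \<in> (\<tau> ^ k) *o S \<Longrightarrow> y \<in> (\<tau> ^ k) *o S \<Longrightarrow> x - y \<in> (\<tau> ^ k) *o S"
  by (rule elt_times_diff) simp_all

lemma tau_sum: "(\<And>i. i \<in> I \<Longrightarrow> f i \<in> (\<tau> ^ k) *o S) \<Longrightarrow> sum f I \<in> (\<tau> ^ k) *o S"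
  by (induction I rule: infinite_finite_induct) (auto intro: tau_add zero_mem_elt_times)

lemma tau_scale: "d \<in> D \<Longrightarrow> x \<in> (\<tau> ^ k) *o S \<Longrightarrow> d * x \<in> (\<tau> ^ k) *o S"
  by (rule elt_times_scale) simp_all

lemma tau_antimono:
  assumes "j \<le> k"
  shows "(\<tau> ^ k) *o S \<subseteq> (\<tau> ^ j) *o S"
proof
  fix x assume "x \<in> (\<tau> ^ k) *o S"
  then obtain y where y: "y \<in> S" "x = \<tau> ^ k * y" unfolding mem_elt_times by blast
  then have "x = \<tau> ^ j * (\<tau> ^ (k - j) * y)" using assms by (simp flip: mult.assoc power_add)
  then show "x \<in> (\<tau> ^ j) *o S" using tau_closed[OF y(1)] unfolding mem_elt_times by blast
qed

lemma tau_prime: "x \<in> S \<Longrightarrow> y \<in> S \<Longrightarrow> x * y \<in> \<tau> *o S \<Longrightarrow> x \<in> \<tau> *o S \<or> y \<in> \<tau> *o S"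
  using unique_maximal_ideal_prime[OF cring_S S_local] by simp

lemma e_notin: "e \<notin> \<tau> *o S"
  using unique_maximal_ideal_one_notin[OF S_local] by simp

text \<open>The equality of ideals gives factors w and w' in both directions. Cancelling t shows
  that w w' = e, so w is a unit of \<open>S\<close> and avoids the maximal ideal. This unit is what
  lets t be extracted from \<alpha>^2 in the ramified cases.\<close>

lemma tau_n:
  obtains w where "w \<in> S" "w \<notin> \<tau> *o S" "\<tau> ^ n * e = t * w"
proof -
  have "\<tau> ^ n * e \<in> t *o S" unfolding t_tau by (simp add: set_times_intro2)
  then obtain w where w: "w \<in> S" "\<tau> ^ n * e = t * w" unfolding mem_elt_times by blast
  have "t * e \<in> (\<tau> ^ n) *o S" unfolding t_tau[symmetric] by (simp add: set_times_intro2)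
  then obtain w' where w': "w' \<in> S" "t * e = \<tau> ^ n * w'" unfolding mem_elt_times by blast
  have "t ^ 1 * (w * w') = (\<tau> ^ n * e) * w'" by (simp add: w(2) mult.assoc)
  also have "\<dots> = \<tau> ^ n * w'" using w'(1) by (simp add: S_iff mult.assoc)
  finally have "t ^ 1 * (w * w') = t ^ 1 * e" by (simp add: w'(2))
  then have ww': "w * w' = e" unfolding t_cancel .
  have "w \<notin> \<tau> *o S"
  proof
    assume "w \<in> \<tau> *o S"
    then obtain y where "y \<in> S" "w = \<tau> * y" unfolding mem_elt_times by blast
    then have "e = \<tau> * (y * w')" using ww' by (simp add: mult.assoc)
    then show False using e_notin set_times_intro2[OF S_closed(5)[OF \<open>y \<in> S\<close> w'(1)], of \<tau>] by simp
  qed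
  then show thesis using that w by blast
qed

text \<open>Since n > 0, multiplication by t on \<open>S\<close> factors through multiplication by
  \<tau>, and t is cancellable in \<open>L\<close>.\<close>

lemma tau_cancel:
  assumes "x \<in> S" "y \<in> S" "\<tau> ^ k * x = \<tau> ^ k * y"
  shows "x = y"
  using assms
proof (induction k arbitrary: x y)
  case (Suc k)
  obtain w where w: "w \<in> S" "t * e = \<tau> ^ n * w"
    using set_times_intro2[OF S_closed(2), of t] unfolding t_tau mem_elt_times by blast
  obtain m where m: "n = Suc m" using n_pos by (cases n) auto
  have "\<tau> * x = \<tau> * y"
  proof (rule Suc.IH)
    show "\<tau> * x \<in> S" "\<tau> * y \<in> S" using tau_closed[of _ 1] Suc.prems by simp_all
  qed (use Suc.prems(3) in \<open>simp add: mult.assoc mult.left_commute[of \<tau>]\<close>)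
  have "t * z = \<tau> ^ m * w * (\<tau> * z)" if "z \<in> S" for z
  proof -
    have "t * z = (t * e) * z" using that by (simp add: S_iff mult.assoc)
    also have "\<dots> = \<tau> ^ m * w * (\<tau> * z)" unfolding w(2) m by (simp add: mult_ac)
    finally show ?thesis .
  qed
  then have "t ^ 1 * x = t ^ 1 * y" using \<open>\<tau> * x = \<tau> * y\<close> Suc.prems by simp
  then show ?case unfolding t_cancel .
qed simp

lemma tau_cancel_mem:
  assumes "x \<in> S" "\<tau> ^ k * x \<in> (\<tau> ^ (k + j)) *o S"
  shows "x \<in> (\<tau> ^ j) *o S"
proof -
  obtain y where y: "y \<in> S" "\<tau> ^ k * x = \<tau> ^ k * (\<tau> ^ j * y)"
    using assms(2) by (auto simp: mem_elt_times power_add mult.assoc)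
  then have "x = \<tau> ^ j * y" using tau_cancel[OF assms(1) tau_closed] by blast
  then show ?thesis using y(1) unfolding mem_elt_times by blast
qed

lemma D_scale_tau:
  assumes "d \<in> D" "x \<in> S" "x \<notin> \<tau> *o S" "d * x \<in> \<tau> *o S"
  shows "d \<in> t *o D"
proof (rule ccontr)
  assume "d \<notin> t *o D"
  then obtain d' where d': "d' \<in> D" "d * d' = 1" using D_unit assms(1) by blast
  have "d' * (d * x) \<in> \<tau> *o S" using tau_scale[of d' "d * x" 1] d' assms(4) by simp
  moreover have "d' * (d * x) = x" using d'(2) by (metis mult.assoc mult.commute mult_1)
  ultimately show False using assms(3) by simp
qed

lemma tD_scale: "d \<in> t *o D \<Longrightarrow> x \<in> S \<Longrightarrow> d * x \<in> (\<tau> ^ n) *o S"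
proof -
  assume "d \<in> t *o D" "x \<in> S"
  then obtain d' where "d' \<in> D" "d = t * d'" unfolding mem_elt_times by blast
  then show ?thesis
    using set_times_intro2[OF S_closed(6)[OF _ \<open>x \<in> S\<close>], of d' t]
    by (simp add: mult.assoc flip: t_tau)
qed

text \<open>The terms with d i outside of t D have distinct valuations below n. By induction on i,
  the terms before the i-th lie in \<tau>^n S and those after it in \<tau>^(i + 1) S, so the i-th
  does too; cancelling \<tau>^i leaves d i times a unit in \<tau> S.\<close>

lemma independent_of_valuations:
  assumes d: "\<And>i. i < n \<Longrightarrow> d i \<in> D" and u: "\<And>i. i < n \<Longrightarrow> u i \<in> S" "\<And>i. i < n \<Longrightarrow> u i \<notin> \<tau> *o S"
    and rel: "(\<Sum>i<n. d i * (\<tau> ^ i * u i)) \<in> (\<tau> ^ n) *o S" and "i < n"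
  shows "d i \<in> t *o D"
  using \<open>i < n\<close>
proof (induction i rule: less_induct)
  case (less i)
  let ?f = "\<lambda>i. d i * (\<tau> ^ i * u i)"
  have f: "?f j \<in> (\<tau> ^ Suc i) *o S" if "j < n" "j \<noteq> i" for j
  proof (cases "j < i")
    case True
    then have "?f j \<in> (\<tau> ^ n) *o S" using tD_scale[OF less.IH tau_closed[OF u(1)]] that by simp
    then show ?thesis using tau_antimono[of "Suc i" n] less.prems by auto
  next
    case False
    have "\<tau> ^ j * u j \<in> (\<tau> ^ j) *o S" using u(1) that by (simp add: set_times_intro2)
    then have "\<tau> ^ j * u j \<in> (\<tau> ^ Suc i) *o S" using tau_antimono[of "Suc i" j] False that by auto
    then show ?thesis using tau_scale d that by blast
  qed
  have "(\<Sum>i<n. ?f i) = ?f i + (\<Sum>j\<in>{..<n} - {i}. ?f j)"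
    using less.prems by (simp add: sum.remove)
  then have "?f i = (\<Sum>i<n. ?f i) - (\<Sum>j\<in>{..<n} - {i}. ?f j)" by simp
  also have "\<dots> \<in> (\<tau> ^ Suc i) *o S"
    using tau_antimono[of "Suc i" n] less.prems f by (intro tau_diff tau_sum set_mp[OF _ rel]) auto
  finally have "\<tau> ^ i * (d i * u i) \<in> (\<tau> ^ (i + 1)) *o S" by (simp add: mult_ac)
  then have "d i * u i \<in> (\<tau> ^ 1) *o S"
    using d u less.prems by (intro tau_cancel_mem[of _ i 1]) auto
  then show ?case using D_scale_tau[of "d i" "u i"] d u less.prems by simp
qed

text \<open>As \<tau> S is prime and x lies outside of it, the powers of \<tau> can be peeled off y
  one at a time.\<close>

lemma mult_cancel_tau_power:
  assumes "x \<in> S" "x \<notin> \<tau> *o S" "y \<in> S" "x * y \<in> (\<tau> ^ k) *o S"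
  shows "y \<in> (\<tau> ^ k) *o S"
  using assms(3,4)
proof (induction k arbitrary: y)
  case (Suc k)
  have "x * y \<in> \<tau> *o S" using Suc.prems tau_antimono[of 1 "Suc k"] by auto
  then obtain z where z: "z \<in> S" "y = \<tau> * z"
    using tau_prime[OF assms(1) Suc.prems(1)] assms(2) unfolding mem_elt_times by blast
  have "\<tau> ^ 1 * (x * z) \<in> (\<tau> ^ (1 + k)) *o S" using Suc.prems by (simp add: z mult_ac)
  then have "x * z \<in> (\<tau> ^ k) *o S" 
    by (rule tau_cancel_mem[rotated]) (simp add: assms(1) z)
  then have "z \<in> (\<tau> ^ k) *o S" by (rule Suc.IH[OF z(1)])
  then obtain z' where z': "z' \<in> S" "z = \<tau> ^ k * z'" unfolding mem_elt_times by blast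
  then show ?case using set_times_intro2[OF z'(1), of "\<tau> ^ Suc k"] by (simp add: z(2) mult.assoc)
qed (simp add: mem_elt_times)

text \<open>Here \<open>1 - e\<close> is the unit of a further branch, in which \<open>\<nu>\<close> and \<open>\<delta>\<close> vanish.\<close>

lemma independent_add_one:
  assumes "e \<noteq> 1" and S: "\<nu> \<in> S" "\<delta> \<in> S"
    and indep: "\<And>d2 d3. d2 \<in> D \<Longrightarrow> d3 \<in> D \<Longrightarrow> d2 * \<nu> + d3 * \<delta> \<in> (\<tau> ^ n) *o S \<Longrightarrow>
      d2 \<in> t *o D \<and> d3 \<in> t *o D"
    and d: "d1 \<in> D" "d2 \<in> D" "d3 \<in> D" and rel: "d1 + d2 * \<nu> + d3 * \<delta> \<in> t *o A"
  shows "d1 \<in> t *o D \<and> d2 \<in> t *o D \<and> d3 \<in> t *o D"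
proof -
  obtain a where a: "a \<in> A" "d1 + d2 * \<nu> + d3 * \<delta> = t * a" using rel unfolding mem_elt_times by blast
  have e: "e * \<nu> = \<nu>" "e * \<delta> = \<delta>" using S by (simp_all add: S_iff)
  have idem: "(1 - e) * (1 - e) = 1 - e" using e_idem by (simp add: algebra_simps)
  have "(1 - e) * (d1 + d2 * \<nu> + d3 * \<delta>) = (1 - e) * d1 + d2 * (\<nu> - e * \<nu>) + d3 * (\<delta> - e * \<delta>)"
    by (simp add: algebra_simps)
  then have "(1 - e) * d1 = t * ((1 - e) * a)" by (simp add: e a(2) mult.left_commute)
  then have "(1 - e) * d1 \<in> t *o A"
    using set_times_intro2[OF idempotent_mult_A[OF idem a(1)], of t] by simp
  then have d1: "d1 \<in> t *o D" using idempotent_mult_in_tA[OF idem _ d(1)] assms(1) by simp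
  \<comment> \<open>With d1 in t D, its contribution to the branch of e lies in \<tau>^n S and can
    be subtracted.\<close>
  have "e * (d1 + d2 * \<nu> + d3 * \<delta>) = d1 * e + (d2 * (e * \<nu>) + d3 * (e * \<delta>))"
    by (simp add: algebra_simps)
  then have "e * (t * a) = d1 * e + (d2 * \<nu> + d3 * \<delta>)" by (simp only: e a(2))
  then have "d2 * \<nu> + d3 * \<delta> = t * (e * a) - d1 * e" by (simp add: mult.left_commute[of e t])
  moreover have "t * (e * a) \<in> (\<tau> ^ n) *o S"
    unfolding t_tau[symmetric] using a(1) by (simp add: S_def set_times_intro2)
  ultimately have "d2 * \<nu> + d3 * \<delta> \<in> (\<tau> ^ n) *o S" using tau_diff tD_scale[OF d1] by simp
  then show ?thesis using indep d d1 by blast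
qed

end

text \<open>A supremum in \<open>enat\<close> is 0 on the empty set. Positivity of n excludes this
  and makes the supremum attained: without n itself, all exponents would be at most n - 1.\<close>

lemma normalized_valuation_eq_enatD:
  assumes "normalized_valuation S \<tau> x = enat n" "0 < n"
  shows "x \<in> (\<tau> ^ n) *o S" "x \<notin> (\<tau> ^ Suc n) *o S"
proof -
  let ?N = "{n. x \<in> (\<tau> ^ n) *o S}"
  have le: "k \<le> n" if "k \<in> ?N" for k
    using SUP_upper[OF that, of enat] assms(1) by (simp add: normalized_valuation_def)
  show "x \<notin> (\<tau> ^ Suc n) *o S"
  proof
    assume "x \<in> (\<tau> ^ Suc n) *o S"
    then have "Suc n \<le> n" by (intro le CollectI)
    then show False by simp
  qed
  show "x \<in> (\<tau> ^ n) *o S"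
  proof (rule ccontr)
    assume "x \<notin> (\<tau> ^ n) *o S"
    then have "k \<le> n - 1" if "k \<in> ?N" for k using le[OF that] that by (cases "k = n") auto
    then have "(SUP k\<in>?N. enat k) \<le> enat (n - 1)" by (intro SUP_least) auto
    then show False using assms by (simp add: normalized_valuation_def)
  qed
qed

lemma (in local_factor) normalized_valuationE:
  assumes "normalized_valuation S \<tau> x = enat k" "0 < k"
  obtains u where "u \<in> S" "u \<notin> \<tau> *o S" "x = \<tau> ^ k * u"
proof -
  obtain u where u: "u \<in> S" "x = \<tau> ^ k * u"
    using normalized_valuation_eq_enatD(1)[OF assms] unfolding mem_elt_times by blast
  have "u \<notin> \<tau> *o S"
  proof
    assume "u \<in> \<tau> *o S"
    then obtain v where "v \<in> S" "u = \<tau> * v" unfolding mem_elt_times by blast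
    then have "x \<in> (\<tau> ^ Suc k) *o S" unfolding mem_elt_times by (auto simp: u mult_ac)
    then show False using normalized_valuation_eq_enatD(2)[OF assms] by simp
  qed
  then show thesis using that u by blast
qed

section \<open>The residue field of degree three\<close>

text \<open>Otherwise 1 and the residue of \<alpha> would be a basis of the residue field over k,
  giving dimension two instead of three. The element b is all that case (ii) takes from the
  degree.\<close>

lemma (in cubic_setting) residue_not_spanned_by_two:
  assumes local: "unique_maximal_ideal (ring_on 1 A) (t *o A)"
    and residue: "residue_extension_degree D 1 A (t *o A) 3"
    and \<alpha>: "\<alpha> \<in> A" "\<alpha> \<notin> D + t *o A"
  obtains b where "b \<in> A" "b \<notin> D + \<alpha> *o D + t *o A"
proof (rule ccontr)
  assume "\<not> thesis"
  then have span: "A \<subseteq> D + \<alpha> *o D + t *o A" using that by blast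
  define P where "P = t *o A"
  define Q where "Q = ring_on 1 A Quot P"
  interpret P: ideal P "ring_on 1 A"
    unfolding P_def by (rule maximalideal.axioms(1)[OF unique_maximal_idealD(1)[OF local]])
  interpret Q: ring Q unfolding Q_def by (rule P.quotient_is_ring)
  define \<pi> where "\<pi> x = P +>\<^bsub>ring_on 1 A\<^esub> x" for x
  define k where "k = \<pi> ` D"
  have k: "subfield k Q" and dim: "Q.dimension 3 k (carrier Q)"
    using residue
    by (simp_all add: residue_extension_degree_def field_extension_degree_def Q_def P_def k_def
        \<pi>_def[abs_def])
  have hom: "\<pi> \<in> ring_hom (ring_on 1 A) Q"
    using P.rcos_ring_hom by (simp add: Q_def \<pi>_def[abs_def])
  have \<pi>_P: "\<pi> x = \<zero>\<^bsub>Q\<^esub>" if "x \<in> P" for x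
    using that by (simp add: \<pi>_def Q_def FactRing_def P.a_rcos_const)
  have \<pi>_carrier: "\<pi> x \<in> carrier Q" if "x \<in> A" for x
    using ring_hom_closed[OF hom] that by simp
  have gens: "set [\<pi> \<alpha>, \<pi> 1] \<subseteq> carrier Q" using \<pi>_carrier A_one \<alpha>(1) by simp
  have "carrier Q \<subseteq> Q.Span k [\<pi> \<alpha>, \<pi> 1]"
  proof
    fix X assume "X \<in> carrier Q"
    then obtain x where x: "x \<in> A" "X = \<pi> x"
      by (auto simp: Q_def FactRing_def A_RCOSETS_def' \<pi>_def)
    have "x \<in> D + \<alpha> *o D + t *o A" using span x(1) by blast
    then obtain d d' a where d: "d \<in> D" "d' \<in> D" "a \<in> A" "x = d + \<alpha> * d' + t * a"
      unfolding mem_add_times2 by blast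
    have A: "d \<in> A" "d' \<in> A" "\<alpha> * d' \<in> A" "t * a \<in> A"
      using d D_subset_A A_scale[of d' \<alpha>] A_scale[of t a] \<alpha>(1) by (auto simp: mult.commute)
    have "\<pi> (t * a) = \<zero>\<^bsub>Q\<^esub>" using d(3) by (intro \<pi>_P) (simp add: P_def set_times_intro2)
    moreover have "\<pi> (d' * \<alpha>) = \<pi> d' \<otimes>\<^bsub>Q\<^esub> \<pi> \<alpha>" using ring_hom_mult[OF hom, of d' \<alpha>] A \<alpha> by simp
    moreover have "\<pi> (d * 1) = \<pi> d \<otimes>\<^bsub>Q\<^esub> \<pi> 1" using ring_hom_mult[OF hom, of d 1] A A_one by simp
    ultimately have "X = \<pi> d \<otimes>\<^bsub>Q\<^esub> \<pi> 1 \<oplus>\<^bsub>Q\<^esub> (\<pi> d' \<otimes>\<^bsub>Q\<^esub> \<pi> \<alpha>)"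
      using ring_hom_add[OF hom, of "d + \<alpha> * d'" "t * a"] ring_hom_add[OF hom, of d "\<alpha> * d'"] A
        \<pi>_carrier A_add[of d "\<alpha> * d'"] by (simp add: x d(4) mult.commute[of \<alpha>])
    then have "X = Q.combine [\<pi> d', \<pi> d] [\<pi> \<alpha>, \<pi> 1]"
      using \<pi>_carrier A A_one \<alpha>(1) by (simp add: Q.a_comm)
    moreover have "set [\<pi> d', \<pi> d] \<subseteq> k" using d by (simp add: k_def)
    ultimately show "X \<in> Q.Span k [\<pi> \<alpha>, \<pi> 1]"
      unfolding Q.Span_eq_combine_set[OF k gens] by blast
  qed
  then have "Q.Span k [\<pi> \<alpha>, \<pi> 1] = carrier Q"
    using Q.Span_subgroup_props(1)[OF k gens] by blast
  moreover have "Q.independent k [\<pi> \<alpha>, \<pi> 1]"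
  proof (intro Q.li_Cons)
    show "\<pi> 1 \<notin> Q.Span k []"
      using subfieldE(6)[OF k] ring_hom_one[OF hom] by simp
    show "\<pi> \<alpha> \<notin> Q.Span k [\<pi> 1]"
    proof
      assume "\<pi> \<alpha> \<in> Q.Span k [\<pi> 1]"
      then obtain d where d: "d \<in> D" "\<pi> \<alpha> = \<pi> d \<otimes>\<^bsub>Q\<^esub> \<pi> 1 \<oplus>\<^bsub>Q\<^esub> \<zero>\<^bsub>Q\<^esub>"
        by (auto simp: Q.line_extension_mem_iff k_def)
      then have "\<pi> \<alpha> = \<pi> d"
        using ring_hom_mult[OF hom, of d 1] \<pi>_carrier[of d] D_subset_A A_one by auto
      moreover have "\<alpha> \<in> \<pi> \<alpha>" unfolding \<pi>_def using P.a_rcos_self[of \<alpha>] \<alpha>(1) by simp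
      ultimately obtain a where "a \<in> A" "\<alpha> = d + t * a"
        by (auto simp: \<pi>_def a_r_coset_def' P_def mem_elt_times add.commute)
      then show False using \<alpha>(2) d(1) unfolding mem_add_times by blast
    qed
  qed (use gens in simp_all)
  ultimately have "Q.dimension (length [\<pi> \<alpha>, \<pi> 1]) k (carrier Q)"
    using Q.dimension_independent by metis
  then show False using Q.dimension_is_inj[OF k dim, of 2] by (simp add: numeral_2_eq_2)
qed

text \<open>
  If \<open>\<alpha>\<close> were quadratic over the residue field, its residue would generate a quadratic subfield,
  and for \<open>b\<close> outside of it \<open>1, \<alpha>, b, \<alpha> b\<close> would be independent modulo \<open>t\<close>.
\<close>

lemma (in local_factor) residue_independent:
  assumes e: "e = 1" and \<tau>: "\<tau> = t"
    and \<alpha>: "\<alpha> \<in> A" "\<alpha> \<notin> D + t *o A" and b: "b \<in> A" "b \<notin> D + \<alpha> *o D + t *o A"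
    and d: "d1 \<in> D" "d2 \<in> D" "d3 \<in> D" and rel: "d1 + d2 * \<alpha> + d3 * \<alpha>\<^sup>2 \<in> t *o A"
  shows "d1 \<in> t *o D \<and> d2 \<in> t *o D \<and> d3 \<in> t *o D"
proof -
  have S: "S = A" by (simp add: S_def e)
  note A_mult = S_closed(5)[unfolded S]
  note tA_prime = tau_prime[unfolded S \<tau>]
  have tA_add: "x + y \<in> t *o A" and tA_diff: "x - y \<in> t *o A" if "x \<in> t *o A" "y \<in> t *o A" for x y
    using that by (auto intro: elt_times_add elt_times_diff A_add A_diff)
  have tA_mult: "x * y \<in> t *o A" if "x \<in> A" "y \<in> t *o A" for x y
    using that A_mult by (auto intro: elt_times_scale)
  have tD_tA: "x \<in> t *o A" if "x \<in> t *o D" for x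
    using that D_subset_A unfolding mem_elt_times by blast
  have DA: "x \<in> A" if "x \<in> D" for x using that D_subset_A by blast
  have D_tA: "x \<in> t *o D" if "x \<in> D" "x \<in> t *o A" for x
    using idempotent_mult_in_tA[of 1 x] that by simp
  have linear: "x \<in> t *o D \<and> y \<in> t *o D" if D: "x \<in> D" "y \<in> D" and xy: "x + y * \<alpha> \<in> t *o A" for x y
  proof -
    have y: "y \<in> t *o D"
    proof (rule ccontr)
      assume "y \<notin> t *o D"
      then obtain u where u: "u \<in> D" "y * u = 1" using D_unit D(2) by blast
      have "u * (x + y * \<alpha>) = u * x + (y * u) * \<alpha>" by (simp add: algebra_simps)
      then have "\<alpha> = - (u * x) + u * (x + y * \<alpha>)" by (simp add: u(2))
      moreover obtain a where "a \<in> A" "x + y * \<alpha> = t * a" using xy unfolding mem_elt_times by blast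
      ultimately have "\<alpha> = - (u * x) + t * (u * a)" by (simp add: mult.left_commute[of u])
      moreover have "- (u * x) \<in> D" "u * a \<in> A" using u D \<open>a \<in> A\<close> A_scale by simp_all
      ultimately show False using \<alpha>(2) unfolding mem_add_times by blast
    qed
    then have "x + y * \<alpha> - \<alpha> * y \<in> t *o A" using xy tD_tA tA_mult \<alpha>(1) tA_diff by blast
    then show ?thesis using D_tA[OF D(1)] y by (simp add: mult.commute)
  qed
  show ?thesis
  proof (cases "d3 \<in> t *o D")
    case True
    have "\<alpha>\<^sup>2 \<in> A" using A_mult[OF \<alpha>(1) \<alpha>(1)] by (simp add: power2_eq_square)
    then have "d1 + d2 * \<alpha> + d3 * \<alpha>\<^sup>2 - \<alpha>\<^sup>2 * d3 \<in> t *o A" using True tD_tA tA_mult rel tA_diff by blast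
    then show ?thesis using linear[OF d(1,2)] True by (simp add: mult.commute)
  next
    case False
    then obtain u where u: "u \<in> D" "d3 * u = 1" using D_unit d(3) by blast
    \<comment> \<open>Dividing the supposed relation by the unit d3 turns it into \<alpha>^2 = p
      \<alpha> + q modulo t A.\<close>
    define p where "p = - (u * d2)"
    define q where "q = - (u * d1)"
    have pq: "p \<in> D" "q \<in> D" using u d by (simp_all add: p_def q_def)
    have "u * (d1 + d2 * \<alpha> + d3 * \<alpha>\<^sup>2) = (d3 * u) * \<alpha>\<^sup>2 - (p * \<alpha> + q)"
      by (simp add: p_def q_def algebra_simps)
    then have \<alpha>2: "\<alpha>\<^sup>2 - (p * \<alpha> + q) \<in> t *o A"
      using tA_mult[OF DA[OF u(1)] rel] by (simp add: u(2))
    obtain x1 x2 x3 x4 where x: "x1 \<in> D" "x2 \<in> D" "x3 \<in> D" "x4 \<in> D"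
      and x_rel: "x1 * 1 + x2 * \<alpha> + x3 * b + x4 * (\<alpha> * b) = 0"
      and x_unit: "x1 \<notin> t *o D \<or> x2 \<notin> t *o D \<or> x3 \<notin> t *o D \<or> x4 \<notin> t *o D"
      using four_dependent[of 1 \<alpha> b "\<alpha> * b"] .
    \<comment> \<open>Modulo t, p - \<alpha> is the other root of X^2 - p X - q. So
      \<open>z'\<close> is the conjugate of \<open>z\<close>, and \<open>N\<close> is the norm of
      \<open>z\<close>, taken as an element of \<open>D\<close>.\<close>
    define z where "z = x3 + x4 * \<alpha>"
    define z' where "z' = x3 + x4 * p - x4 * \<alpha>"
    define N where "N = x3 * x3 + x3 * x4 * p - x4 * x4 * q"
    have zA: "z \<in> A" "z' \<in> A" using x pq \<alpha> by (simp_all add: z_def z'_def A_add A_diff A_scale DA)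
    have ND: "N \<in> D" using x pq by (simp add: N_def)
    have zb: "z * b = - (x1 + x2 * \<alpha>)"
      using x_rel by (simp add: z_def algebra_simps eq_neg_iff_add_eq_0)
    have "z' * z = N - x4 * x4 * (\<alpha>\<^sup>2 - (p * \<alpha> + q))"
      by (simp add: z_def z'_def N_def algebra_simps power2_eq_square)
    moreover have err: "x4 * x4 * (\<alpha>\<^sup>2 - (p * \<alpha> + q)) \<in> t *o A" using x \<alpha>2 DA by (intro tA_mult) simp_all
    ultimately have norm: "z' * z + x4 * x4 * (\<alpha>\<^sup>2 - (p * \<alpha> + q)) = N" by simp
    have "z \<in> t *o A"
    proof (cases "N \<in> t *o D")
      case True
      have "z' * z = N - x4 * x4 * (\<alpha>\<^sup>2 - (p * \<alpha> + q))" using norm by (simp add: algebra_simps)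
      then have "z' * z \<in> t *o A" using tA_diff[OF tD_tA[OF True] err] by simp
      then consider "z \<in> t *o A" | "z' \<in> t *o A" using tA_prime zA by blast
      then show ?thesis
      proof cases
        case 2
        \<comment> \<open>If the conjugate lies in t A, independence of 1 and \<alpha> modulo t
          forces x3 and x4 into t D, and then z is in t A as well.\<close>
        have "x3 + x4 * p \<in> t *o D \<and> - x4 \<in> t *o D"
          using 2 x pq by (intro linear) (simp_all add: z'_def)
        then have "x4 \<in> t *o D" "x3 + x4 * p \<in> t *o D" using tD_closed(4)[of "- 1" "- x4"] by simp_all
        then have "x4 \<in> t *o A" "x3 + x4 * p - p * x4 \<in> t *o D"
          using tD_tA tD_closed(3,4) pq by blast+
        then show ?thesis
          using tD_tA[of x3] tA_add tA_mult[OF \<alpha>(1), of x4] by (simp add: z_def mult.commute)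
      qed
    next
      case False
      then obtain v where v: "v \<in> D" "N * v = 1" using D_unit ND by blast
      \<comment> \<open>With an invertible norm, multiplying z b = - (x1 + x2 \<alpha>) by the
        conjugate would express b by 1 and \<alpha> modulo t A, against the choice of b.\<close>
      have "N * b = z' * (z * b) + x4 * x4 * (\<alpha>\<^sup>2 - (p * \<alpha> + q)) * b"
        unfolding norm[symmetric] by (simp add: algebra_simps)
      also have "\<dots> = - ((x3 + x4 * p) * x1 - x4 * x2 * q)
          - ((x3 + x4 * p) * x2 - x4 * x1 - x4 * x2 * p) * \<alpha>
          + (x4 * x2 * (\<alpha>\<^sup>2 - (p * \<alpha> + q)) + b * (x4 * x4 * (\<alpha>\<^sup>2 - (p * \<alpha> + q))))"
        unfolding zb z'_def by (simp add: algebra_simps power2_eq_square)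
      finally have Nb: "N * b = - ((x3 + x4 * p) * x1 - x4 * x2 * q)
          - ((x3 + x4 * p) * x2 - x4 * x1 - x4 * x2 * p) * \<alpha>
          + (x4 * x2 * (\<alpha>\<^sup>2 - (p * \<alpha> + q)) + b * (x4 * x4 * (\<alpha>\<^sup>2 - (p * \<alpha> + q))))"
        (is "_ = - ?r - ?s * \<alpha> + ?w") .
      have "?w \<in> t *o A"
        using x \<alpha>2 DA err b(1) by (intro tA_add tA_mult) simp_all
      then obtain a where a: "a \<in> A" "?w = t * a" unfolding mem_elt_times by blast
      have "b = v * (N * b)" using v(2) by (metis mult.assoc mult.commute mult_1)
      also have "\<dots> = - (v * ?r) + \<alpha> * (- (v * ?s)) + t * (v * a)"
        unfolding Nb a(2) by (simp add: algebra_simps)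
      finally have "b = - (v * ?r) + \<alpha> * (- (v * ?s)) + t * (v * a)" .
      moreover have "- (v * ?r) \<in> D" "- (v * ?s) \<in> D" "v * a \<in> A"
        using v x pq a A_scale by simp_all
      ultimately have False using b(2) unfolding mem_add_times2 by blast
      then show ?thesis ..
    qed
    then have x34: "x3 \<in> t *o D \<and> x4 \<in> t *o D" using linear[of x3 x4] x by (simp add: z_def)
    \<comment> \<open>Since z is in t A, so is x1 + x2 \<alpha>; then all four coefficients are in t
      D, contrary to their choice.\<close>
    have "x1 + x2 * \<alpha> = 0 - b * z" using zb by (simp add: algebra_simps eq_neg_iff_add_eq_0)
    also have "\<dots> \<in> t *o A"
      by (intro tA_diff tA_mult[OF b(1) \<open>z \<in> t *o A\<close>] zero_mem_elt_times A_zero)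
    finally have "x1 + x2 * \<alpha> \<in> t *o A" .
    then show ?thesis using linear[OF x(1,2)] x34 x_unit by blast
  qed
qed

section \<open>The five cases\<close>

context local_factor
begin

lemma S_subset_A: "x \<in> S \<Longrightarrow> x \<in> A"
  by (simp add: S_iff)

lemma tau_square: "u \<in> S \<Longrightarrow> u \<notin> \<tau> *o S \<Longrightarrow> u * u \<notin> \<tau> *o S"
  using tau_prime by blast

section \<open>Independence of elements of prescribed valuations\<close>

lemma independent_valuations_012:
  assumes "n = 3" and u: "u0 \<in> S" "u1 \<in> S" "u2 \<in> S" "u0 \<notin> \<tau> *o S" "u1 \<notin> \<tau> *o S" "u2 \<notin> \<tau> *o S"
    and d: "d0 \<in> D" "d1 \<in> D" "d2 \<in> D"
    and rel: "d0 * u0 + d1 * (\<tau> * u1) + d2 * (\<tau>\<^sup>2 * u2) \<in> t *o S"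
  shows "d0 \<in> t *o D \<and> d1 \<in> t *o D \<and> d2 \<in> t *o D"
proof -
  have *: "[d0, d1, d2] ! i \<in> t *o D" if "i < 3" for i
  proof (rule independent_of_valuations[where u = "\<lambda>i. [u0, u1, u2] ! i"])
    show "(\<Sum>i<n. [d0, d1, d2] ! i * (\<tau> ^ i * [u0, u1, u2] ! i)) \<in> (\<tau> ^ n) *o S"
      using rel unfolding t_tau \<open>n = 3\<close> by (simp add: numeral_3_eq_3 numeral_2_eq_2)
  qed (use that u d \<open>n = 3\<close> in \<open>auto simp: numeral_3_eq_3 less_Suc_eq\<close>)
  show ?thesis using *[of 0] *[of 1] *[of 2] by simp
qed

lemma independent_valuations_01:
  assumes "n = 2" and u: "u0 \<in> S" "u1 \<in> S" "u0 \<notin> \<tau> *o S" "u1 \<notin> \<tau> *o S"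
    and d: "d0 \<in> D" "d1 \<in> D" and rel: "d0 * u0 + d1 * (\<tau> * u1) \<in> (\<tau> ^ n) *o S"
  shows "d0 \<in> t *o D \<and> d1 \<in> t *o D"
proof -
  have *: "[d0, d1] ! i \<in> t *o D" if "i < 2" for i
  proof (rule independent_of_valuations[where u = "\<lambda>i. [u0, u1] ! i"])
    show "(\<Sum>i<n. [d0, d1] ! i * (\<tau> ^ i * [u0, u1] ! i)) \<in> (\<tau> ^ n) *o S"
      using rel unfolding \<open>n = 2\<close> by (simp add: numeral_2_eq_2)
  qed (use that u d \<open>n = 2\<close> in \<open>auto simp: numeral_2_eq_2 less_Suc_eq\<close>)
  show ?thesis using *[of 0] *[of 1] by simp
qed

text \<open>\<delta> has to supply the valuation missing from 1 and \<alpha>. For even r, \<alpha>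
  has valuation 1 and \<alpha>^2 has valuation 2. For odd r, \<alpha>^2 has valuation 4, one more
  than t, so \<delta> = \<alpha>^2 / t has valuation 1 while \<alpha> has valuation 2.\<close>

lemma dual_one_ramified:
  assumes e: "e = 1" and n: "n = 3" and val: "admissible_one_ramified A \<tau> r \<alpha>"
    and cubic: "cubic_ring D B" and B: "B = D + (t ^ k) *o C_one_ramified D A t r \<alpha>"
  shows "dual_isomorphic_to D B (D + (t ^ (r div 2) * \<alpha>) *o D + (t ^ (k + r)) *o A)"
proof -
  have S: "S = A" by (simp add: S_def e)
  note A_mult = S_closed(5)[unfolded S]
  have one: "1 \<in> S" "1 \<notin> \<tau> *o S" using S_closed(2) e_notin by (simp_all add: e)
  have \<tau>A: "\<tau> * x \<in> A" if "x \<in> A" for x using tau_closed[of x 1] that by (simp add: S)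
  have \<alpha>: "\<alpha> \<in> A" using val by (simp add: admissible_one_ramified_def)
  show ?thesis
  proof (cases "even r")
    case True
    then have "normalized_valuation S \<tau> \<alpha> = enat 1"
      using val by (simp add: admissible_one_ramified_def S one_enat_def)
    then obtain u where u: "u \<in> S" "u \<notin> \<tau> *o S" "\<alpha> = \<tau> * u"
      using normalized_valuationE by (metis power_one_right zero_less_one)
    show ?thesis
    proof (rule dual_isomorphic_to_of_basis[OF \<alpha> _ _ _ _ _ _ cubic B[unfolded C_one_ramified_def]])
      show "\<alpha>\<^sup>2 \<in> A" "\<alpha> * \<alpha>\<^sup>2 \<in> A" using A_mult \<alpha> by (simp_all add: power2_eq_square)
      show "(t ^ (r div 2) * \<alpha>)\<^sup>2 = 0 * (t ^ (r div 2) * \<alpha>) + t ^ r * \<alpha>\<^sup>2"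
        using True by (simp add: power_mult_distrib flip: power_mult)
      fix d1 d2 d3 assume d: "d1 \<in> D" "d2 \<in> D" "d3 \<in> D" and "d1 + d2 * \<alpha> + d3 * \<alpha>\<^sup>2 \<in> t *o A"
      then have "d1 * 1 + d2 * (\<tau> * u) + d3 * (\<tau>\<^sup>2 * (u * u)) \<in> t *o S"
        by (simp add: S u(3) power2_eq_square mult_ac)
      then show "d1 \<in> t *o D \<and> d2 \<in> t *o D \<and> d3 \<in> t *o D"
        using independent_valuations_012[OF n one(1) u(1) _ one(2) u(2) tau_square[OF u(1,2)] d] u(1)
        by simp
    qed simp_all
  next
    case False
    then have "normalized_valuation S \<tau> \<alpha> = enat 2"
      using val by (simp add: admissible_one_ramified_def S numeral_eq_enat)
    then obtain u where u: "u \<in> S" "u \<notin> \<tau> *o S" "\<alpha> = \<tau>\<^sup>2 * u"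
      using normalized_valuationE by (metis zero_less_numeral)
    obtain w where w: "w \<in> S" "w \<notin> \<tau> *o S" "\<tau> ^ 3 = t * w"
      using tau_n by (metis e mult_1_right n)
    define y where "y = w * (u * u)"
    have y: "y \<in> S" "y \<notin> \<tau> *o S"
      using w u tau_prime[of w "u * u"] tau_square[of u] by (auto simp: y_def)
    have \<alpha>2: "\<alpha>\<^sup>2 = t * (\<tau> * y)"
    proof -
      have "\<alpha>\<^sup>2 = \<tau> ^ 3 * (\<tau> * (u * u))" by (simp add: u(3) power2_eq_square power3_eq_cube mult_ac)
      then show ?thesis by (simp add: w(3) y_def mult_ac)
    qed
    show ?thesis
    proof (rule dual_isomorphic_to_of_basis[OF \<alpha> _ _ _ _ _ _ cubic B[unfolded C_one_ramified_def]])
      show \<delta>: "\<tau> * y \<in> A" using \<tau>A y by (simp add: S)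
      show "\<alpha> * (\<tau> * y) \<in> A" using A_mult \<alpha> \<delta> by blast
      have "(t ^ (r div 2) * \<alpha>)\<^sup>2 = t ^ (2 * (r div 2)) * \<alpha>\<^sup>2"
        by (simp add: power_mult_distrib mult.commute flip: power_mult)
      \<comment> \<open>The factor t extracted from \<alpha>^2 compensates the rounding in
        \<open>r div 2\<close> for odd r.\<close>
      also have "\<dots> = t ^ (2 * (r div 2) + 1) * (\<tau> * y)" by (simp add: \<alpha>2 mult_ac)
      also have "2 * (r div 2) + 1 = r" using False by simp
      finally show "(t ^ (r div 2) * \<alpha>)\<^sup>2 = 0 * (t ^ (r div 2) * \<alpha>) + t ^ r * (\<tau> * y)" by simp
      fix d1 d2 d3 assume d: "d1 \<in> D" "d2 \<in> D" "d3 \<in> D" and "d1 + d2 * \<alpha> + d3 * (\<tau> * y) \<in> t *o A"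
      then have "d1 * 1 + d3 * (\<tau> * y) + d2 * (\<tau>\<^sup>2 * u) \<in> t *o S"
        by (simp add: S u(3) add_ac)
      then show "d1 \<in> t *o D \<and> d2 \<in> t *o D \<and> d3 \<in> t *o D"
        using independent_valuations_012[OF n one(1) y(1) u(1) one(2) y(2) u(2) d(1,3,2)] by simp
    qed simp_all
  qed
qed

lemma dual_one_unramified:
  assumes e: "e = 1" and \<tau>: "\<tau> = t" and residue: "residue_extension_degree D 1 A (t *o A) 3"
    and adm: "admissible_one_unramified D A t \<alpha>"
    and cubic: "cubic_ring D B" and B: "B = D + (t ^ k) *o C_one_unramified D A t r \<alpha>"
  shows "dual_isomorphic_to D B (D + (t ^ r * \<alpha>) *o D + (t ^ (k + 2 * r)) *o A)"
proof -
  have S: "S = A" by (simp add: S_def e)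
  have \<alpha>: "\<alpha> \<in> A" "\<alpha> \<notin> D + t *o A"
    using adm by (auto simp: admissible_one_unramified_def Units_def)
  have "unique_maximal_ideal (ring_on 1 A) (t *o A)" using S_local by (simp add: S e \<tau>)
  then obtain b where b: "b \<in> A" "b \<notin> D + \<alpha> *o D + t *o A"
    using residue_not_spanned_by_two residue \<alpha> by blast
  show ?thesis
  proof (rule dual_isomorphic_to_of_basis[OF \<alpha>(1) _ _ residue_independent[OF e \<tau> \<alpha> b] _ _ _ cubic
        B[unfolded C_one_unramified_def]])
    show "\<alpha>\<^sup>2 \<in> A" "\<alpha> * \<alpha>\<^sup>2 \<in> A"
      using S_closed(5)[unfolded S] \<alpha>(1) by (simp_all add: power2_eq_square)
    show "(t ^ r * \<alpha>)\<^sup>2 = 0 * (t ^ r * \<alpha>) + t ^ (2 * r) * \<alpha>\<^sup>2"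
      by (simp add: power_mult_distrib mult.commute flip: power_mult)
  qed simp_all
qed

text \<open>With \<nu> = e + t^q \<alpha>, idempotency gives \<nu>^2 = \<nu> + t^q \<delta> for
  \<delta> = \<nu> \<alpha>. Thus \<nu> and \<delta> are \<nu> times e and \<alpha>, and since \<nu>
  is outside of \<tau> S, independence of e and \<alpha> carries over to them.\<close>

lemma dual_C_two:
  assumes "e \<noteq> 1" and \<alpha>: "\<alpha> \<in> S" and unit: "e + t ^ q * \<alpha> \<notin> \<tau> *o S"
    and indep: "\<And>d d'. d \<in> D \<Longrightarrow> d' \<in> D \<Longrightarrow> d * e + d' * \<alpha> \<in> (\<tau> ^ n) *o S \<Longrightarrow>
      d \<in> t *o D \<and> d' \<in> t *o D"
    and cubic: "cubic_ring D B" and B: "B = D + (t ^ k) *o C_two D A t e l q \<alpha>"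
  shows "dual_isomorphic_to D B (D + (t ^ l * (e + t ^ q * \<alpha>)) *o D + (t ^ (k + 2 * l + q)) *o A)"
proof -
  define \<nu> where "\<nu> = e + t ^ q * \<alpha>"
  define \<delta> where "\<delta> = \<alpha> + t ^ q * (\<alpha> * \<alpha>)"
  have e\<alpha>: "e * \<alpha> = \<alpha>" using \<alpha> by (simp add: S_iff)
  have \<nu>: "\<nu> \<in> S" and \<delta>: "\<delta> \<in> S" using \<alpha> by (simp_all add: \<nu>_def \<delta>_def)
  have "dual_isomorphic_to D B (D + (t ^ l * \<nu>) *o D + (t ^ (k + (2 * l + q))) *o A)"
  proof (rule dual_isomorphic_to_of_basis[where \<delta> = \<delta>, OF _ _ _ _ _ _ _ cubic
        B[unfolded C_two_def \<nu>_def[symmetric]]])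
    show "\<nu> \<in> A" "\<delta> \<in> A" "\<nu> * \<delta> \<in> A" using \<nu> \<delta> S_closed(5) S_subset_A by blast+
    have "\<nu> * \<nu> = e * e + (e * \<alpha> + e * \<alpha>) * t ^ q + t ^ q * t ^ q * (\<alpha> * \<alpha>)"
      by (simp add: \<nu>_def algebra_simps)
    also have "\<dots> = \<nu> + t ^ q * \<delta>"
      unfolding e_idem e\<alpha> by (simp add: \<nu>_def \<delta>_def algebra_simps)
    finally have square: "\<nu> * \<nu> = \<nu> + t ^ q * \<delta>" .
    have "(t ^ l * \<nu>)\<^sup>2 = t ^ l * t ^ l * (\<nu> * \<nu>)" by (simp add: power2_eq_square mult_ac)
    also have "\<dots> = t ^ l * (t ^ l * \<nu>) + t ^ l * t ^ l * t ^ q * \<delta>"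
      unfolding square by (simp add: distrib_left mult_ac)
    also have "t ^ l * t ^ l * t ^ q = t ^ (2 * l + q)" by (simp add: mult_2 power_add)
    finally show "(t ^ l * \<nu>)\<^sup>2 = t ^ l * (t ^ l * \<nu>) + t ^ (2 * l + q) * \<delta>" .
    fix d1 d2 d3
    assume "d1 \<in> D" "d2 \<in> D" "d3 \<in> D" "d1 + d2 * \<nu> + d3 * \<delta> \<in> t *o A"
    then show "d1 \<in> t *o D \<and> d2 \<in> t *o D \<and> d3 \<in> t *o D"
    proof (rule independent_add_one[OF assms(1) \<nu> \<delta>, rotated])
      fix d d' assume d: "d \<in> D" "d' \<in> D" and rel: "d * \<nu> + d' * \<delta> \<in> (\<tau> ^ n) *o S"
      have "\<nu> * (d * e + d' * \<alpha>) = d * (e * e + t ^ q * (e * \<alpha>)) + d' * (e * \<alpha> + t ^ q * (\<alpha> * \<alpha>))"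
        by (simp add: \<nu>_def algebra_simps)
      also have "\<dots> = d * \<nu> + d' * \<delta>" by (simp add: e_idem e\<alpha> \<nu>_def \<delta>_def)
      finally have "\<nu> * (d * e + d' * \<alpha>) \<in> (\<tau> ^ n) *o S" using rel by simp
      then have "d * e + d' * \<alpha> \<in> (\<tau> ^ n) *o S"
        using mult_cancel_tau_power[OF \<nu>] unit d \<alpha> by (simp add: \<nu>_def)
      then show "d \<in> t *o D \<and> d' \<in> t *o D" using indep d by blast
    qed
  qed simp_all
  then show ?thesis by (simp add: \<nu>_def add.assoc)
qed

text \<open>In the first family e and \<alpha> have valuations 0 and 1. In the second, \<alpha>^2
  has the valuation 2 of t, so \<delta> = \<alpha>^2 / t has valuation 0 and complements
  \<alpha>.\<close>

lemma dual_two_ramified: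
  assumes e: "e \<noteq> 1" and n: "n = 2" and adm: "admissible_two_ramified A e \<tau> \<alpha>"
    and cubic: "cubic_ring D B"
  shows "B = D + (t ^ k) *o C_two D A t e l q \<alpha> \<Longrightarrow>
      dual_isomorphic_to D B (D + (t ^ l * (e + t ^ q * \<alpha>)) *o D + (t ^ (k + 2 * l + q)) *o A)"
    and "B = D + (t ^ k) *o C_two_ramified D A t r \<alpha> \<Longrightarrow>
      dual_isomorphic_to D B (D + (t ^ r * \<alpha>) *o D + (t ^ (k + 2 * r + 1)) *o A)"
proof -
  have \<alpha>: "\<alpha> \<in> S" using adm by (simp add: admissible_two_ramified_def S_def)
  have "normalized_valuation S \<tau> \<alpha> = enat 1"
    using adm by (simp add: admissible_two_ramified_def S_def one_enat_def)
  then obtain u where u: "u \<in> S" "u \<notin> \<tau> *o S" "\<alpha> = \<tau> * u"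
    using normalized_valuationE by (metis power_one_right zero_less_one)
  {
    assume B: "B = D + (t ^ k) *o C_two D A t e l q \<alpha>"
    show "dual_isomorphic_to D B (D + (t ^ l * (e + t ^ q * \<alpha>)) *o D + (t ^ (k + 2 * l + q)) *o A)"
    proof (rule dual_C_two[OF e \<alpha> _ _ cubic B])
      show "e + t ^ q * \<alpha> \<notin> \<tau> *o S"
      proof
        assume "e + t ^ q * \<alpha> \<in> \<tau> *o S"
        moreover have "t ^ q * \<alpha> \<in> \<tau> *o S"
          unfolding u(3) by (intro elt_times_scale set_times_intro2) (use u in simp_all)
        ultimately have "e + t ^ q * \<alpha> - t ^ q * \<alpha> \<in> \<tau> *o S" 
          by (rule tau_diff[of _ 1, unfolded power_one_right])
        then show False using e_notin by simp
      qed
      show "d \<in> t *o D \<and> d' \<in> t *o D"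
        if "d \<in> D" "d' \<in> D" "d * e + d' * \<alpha> \<in> (\<tau> ^ n) *o S" for d d'
        using independent_valuations_01[OF n S_closed(2) u(1) e_notin u(2)] that by (simp add: u(3))
    qed
  }
  {
    assume B: "B = D + (t ^ k) *o C_two_ramified D A t r \<alpha>"
    obtain w where w: "w \<in> S" "w \<notin> \<tau> *o S" "\<tau>\<^sup>2 * e = t * w"
      using tau_n unfolding n by blast
    define \<delta> where "\<delta> = w * (u * u)"
    have \<delta>: "\<delta> \<in> S" "\<delta> \<notin> \<tau> *o S"
      using w u tau_prime[of w "u * u"] tau_square[of u] by (auto simp: \<delta>_def)
    have "\<alpha>\<^sup>2 = \<tau>\<^sup>2 * ((e * u) * u)" using u(1) by (simp add: u(3) S_iff power2_eq_square mult_ac)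
    also have "\<dots> = (\<tau>\<^sup>2 * e) * (u * u)" by (simp add: mult_ac)
    finally have \<alpha>2: "\<alpha>\<^sup>2 = t * \<delta>" unfolding w(3) by (simp add: \<delta>_def mult_ac)
    have "dual_isomorphic_to D B (D + (t ^ r * \<alpha>) *o D + (t ^ (k + (2 * r + 1))) *o A)"
    proof (rule dual_isomorphic_to_of_basis[where \<delta> = \<delta>, OF _ _ _ _ _ _ _ cubic
        B[unfolded C_two_ramified_def]])
      show "\<alpha> \<in> A" "\<delta> \<in> A" "\<alpha> * \<delta> \<in> A" using \<alpha> \<delta>(1) S_closed(5) S_subset_A by blast+
      have "(t ^ r * \<alpha>)\<^sup>2 = t ^ (2 * r) * \<alpha>\<^sup>2"
        by (simp add: power_mult_distrib mult.commute flip: power_mult)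
      then show "(t ^ r * \<alpha>)\<^sup>2 = 0 * (t ^ r * \<alpha>) + t ^ (2 * r + 1) * \<delta>"
        unfolding \<alpha>2 by (simp add: mult_ac)
      fix d1 d2 d3
      assume "d1 \<in> D" "d2 \<in> D" "d3 \<in> D" "d1 + d2 * \<alpha> + d3 * \<delta> \<in> t *o A"
      then show "d1 \<in> t *o D \<and> d2 \<in> t *o D \<and> d3 \<in> t *o D"
      proof (rule independent_add_one[OF e \<alpha> \<delta>(1), rotated])
        fix d d' assume d: "d \<in> D" "d' \<in> D" and "d * \<alpha> + d' * \<delta> \<in> (\<tau> ^ n) *o S"
        then have "d' * \<delta> + d * (\<tau> * u) \<in> (\<tau> ^ n) *o S" by (simp add: u(3) add.commute)
        then show "d \<in> t *o D \<and> d' \<in> t *o D"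
          using independent_valuations_01[OF n \<delta>(1) u(1) \<delta>(2) u(2) d(2,1)] by blast
      qed
    qed simp_all
    then show "dual_isomorphic_to D B (D + (t ^ r * \<alpha>) *o D + (t ^ (k + 2 * r + 1)) *o A)"
      by (simp add: add.assoc)
  }
qed

text \<open>Everything rests on \<alpha> not being congruent modulo t to an element of e D: a
  relation d e + d' \<alpha> in t S with d' invertible would make it so.\<close>

lemma dual_two_unramified:
  assumes e: "e \<noteq> 1" and \<tau>: "\<tau> = t" and n: "n = 1" and adm: "admissible_two_unramified D A t e \<alpha>"
    and cubic: "cubic_ring D B" and B: "B = D + (t ^ k) *o C_two D A t e l q \<alpha>"
  shows "dual_isomorphic_to D B (D + (t ^ l * (e + t ^ q * \<alpha>)) *o D + (t ^ (k + 2 * l + q)) *o A)"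
proof (rule dual_C_two[OF e _ _ _ cubic B])
  show \<alpha>: "\<alpha> \<in> S" using adm by (simp add: admissible_two_unramified_def S_def)
  have \<alpha>_eq: False if "\<alpha> = e * d + t * x" "d \<in> D" "x \<in> S" for d x
  proof -
    have "\<alpha> \<in> e *o D + t *o S" unfolding mem_add_times using that set_times_intro2[of d D e] by blast
    then show False using adm by (simp add: admissible_two_unramified_def S_def)
  qed
  show "e + t ^ q * \<alpha> \<notin> \<tau> *o S"
  proof
    assume "e + t ^ q * \<alpha> \<in> \<tau> *o S"
    then obtain x where x: "x \<in> S" "e + t ^ q * \<alpha> = t * x" unfolding \<tau> mem_elt_times by blast
    show False
    \<comment> \<open>For q = 0 the residue of \<alpha> would be that of - e; for positive q, \<nu>
      is congruent to e, whatever \<alpha> is.\<close>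
    proof (cases q)
      case 0
      have "\<alpha> = (e + \<alpha>) - e" by simp
      also have "\<dots> = e * (- 1) + t * x" using x(2) by (simp add: 0)
      finally show False by (rule \<alpha>_eq) (use x(1) in simp_all)
    next
      case (Suc p)
      have "e = (e + t ^ q * \<alpha>) - t ^ q * \<alpha>" by simp
      also have "\<dots> = t * (x - t ^ p * \<alpha>)" unfolding x(2) by (simp add: Suc algebra_simps)
      also have "\<dots> \<in> \<tau> *o S" unfolding \<tau> using x(1) \<alpha> by (intro set_times_intro2) simp
      finally show False using e_notin by simp
    qed
  qed
  fix d d' assume d: "d \<in> D" "d' \<in> D" and rel: "d * e + d' * \<alpha> \<in> (\<tau> ^ n) *o S"
  then obtain x where x: "x \<in> S" "d * e + d' * \<alpha> = t * x" by (auto simp: \<tau> n mem_elt_times)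
  have d': "d' \<in> t *o D"
  proof (rule ccontr)
    assume "d' \<notin> t *o D"
    then obtain v where v: "v \<in> D" "d' * v = 1" using D_unit d(2) by blast
    have "\<alpha> = (d' * v) * \<alpha>" by (simp add: v)
    also have "\<dots> = v * (d * e + d' * \<alpha>) - v * (d * e)" by (simp add: algebra_simps)
    also have "\<dots> = e * (- (v * d)) + t * (v * x)" unfolding x(2) by (simp add: algebra_simps)
    finally show False by (rule \<alpha>_eq) (use v d x in simp_all)
  qed
  have "d * e = (d * e + d' * \<alpha>) - d' * \<alpha>" by simp
  also have "\<dots> \<in> (\<tau> ^ n) *o S" using rel tD_scale[OF d' \<alpha>] by (rule tau_diff)
  finally have "d * e \<in> \<tau> *o S" by (simp add: n)
  then show "d \<in> t *o D \<and> d' \<in> t *o D" using D_scale_tau[OF d(1) S_closed(2) e_notin] d' by blast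
qed

end

text \<open>If e were 1, the first projection would be injective on \<open>L\<close>, but (0, 0) and
  (0, 1) have distinct preimages with the same first projection.\<close>

lemma two_branches_ne_one:
  fixes K :: "'a::comm_ring_1 set"
  assumes "two_branches K e" "1 \<in> K" "0 \<in> K"
  shows "e \<noteq> 1"
proof
  assume e: "e = 1"
  obtain \<phi> where \<phi>: "\<phi> \<in> ring_iso whole_ring (RDirProd (ring_on e (e *o UNIV)) (ring_on 1 K))"
    and fst: "\<And>x. fst (\<phi> x) = e * x"
    using assms(1) unfolding two_branches_def by blast
  have bij: "bij_betw \<phi> UNIV ((e *o UNIV) \<times> K)"
    using \<phi> by (simp add: ring_iso_def RDirProd_carrier)
  have "(0, 0) \<in> (e *o UNIV) \<times> K" "(0, 1) \<in> (e *o UNIV) \<times> K"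
    using assms by (simp_all add: zero_mem_elt_times)
  then obtain x y where xy: "\<phi> x = (0, 0)" "\<phi> y = (0, 1)"
    using bij unfolding bij_betw_def by (metis imageE)
  then have "x = 0" "y = 0" using fst[of x] fst[of y] by (simp_all add: e)
  then show False using xy by simp
qed

context cubic_setting
begin

text \<open>The three coordinate idempotents \<open>E\<^sub>i\<close> are the only primitive ones, since \<open>f = E\<^sub>i + (f - E\<^sub>i)\<close>
  as soon as \<open>E\<^sub>i f \<noteq> 0\<close>.\<close>

lemma three_branches_idempotents:
  assumes "three_branches K" and prim: "primitive_idempotent A e" "primitive_idempotent A e'" "e \<noteq> e'"
  shows "e * e' = 0" "e + e' \<noteq> 1"
proof -
  let ?R = "RDirProd (ring_on 1 K) (RDirProd (ring_on 1 K) (ring_on 1 K))"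
  obtain \<phi> where iso: "\<phi> \<in> ring_iso whole_ring ?R" and \<phi>K: "\<And>x. x \<in> K \<Longrightarrow> \<phi> x = (x, x, x)"
    using assms(1) unfolding three_branches_def by blast
  have bij: "bij_betw \<phi> UNIV (K \<times> K \<times> K)"
    using iso by (simp add: ring_iso_def RDirProd_carrier)
  have inj: "x = y" if "\<phi> x = \<phi> y" for x y using bij that by (simp add: bij_betw_def inj_eq)
  have \<phi>_mult: "\<phi> (x * y) = (fst (\<phi> x) * fst (\<phi> y), fst (snd (\<phi> x)) * fst (snd (\<phi> y)),
      snd (snd (\<phi> x)) * snd (snd (\<phi> y)))" for x y
    using ring_iso_memE(2)[OF iso, of x y]
    by (simp add: RDirProd_def DirProd_def monoid.defs split: prod.splits)
  have \<phi>_add: "\<phi> (x + y) = (fst (\<phi> x) + fst (\<phi> y), fst (snd (\<phi> x)) + fst (snd (\<phi> y)),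
      snd (snd (\<phi> x)) + snd (snd (\<phi> y)))" for x y
    using ring_iso_memE(3)[OF iso, of x y]
    by (simp add: RDirProd_def DirProd_def monoid.defs split: prod.splits)
  have \<phi>0: "\<phi> 0 = (0, 0, 0)" and \<phi>1: "\<phi> 1 = (1, 1, 1)" using \<phi>K K_closed(1,2) by simp_all
  have surj: "\<exists>x. \<phi> x = y" if "y \<in> K \<times> K \<times> K" for y
    using bij that unfolding bij_betw_def by (metis imageE)
  obtain E1 E2 E3 where E: "\<phi> E1 = (1, 0, 0)" "\<phi> E2 = (0, 1, 0)" "\<phi> E3 = (0, 0, 1)"
    using surj[of "(1, 0, 0)"] surj[of "(0, 1, 0)"] surj[of "(0, 0, 1)"] K_closed(1,2) by auto
  have E_idem: "E1 * E1 = E1" "E2 * E2 = E2" "E3 * E3 = E3"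
    by (rule inj, simp add: \<phi>_mult E)+
  have E_nz: "E1 \<noteq> 0" "E2 \<noteq> 0" "E3 \<noteq> 0" using E \<phi>0 by auto
  have E_mult: "E1 * E2 = 0" "E1 * E3 = 0" "E2 * E3 = 0" "E2 * E1 = 0" "E3 * E1 = 0" "E3 * E2 = 0"
    by (rule inj, simp add: \<phi>_mult E \<phi>0)+
  have E_add: "E1 + E2 \<noteq> 1" "E1 + E3 \<noteq> 1" "E2 + E3 \<noteq> 1" "E2 + E1 \<noteq> 1" "E3 + E1 \<noteq> 1" "E3 + E2 \<noteq> 1"
    using \<phi>_add[of E1 E2] \<phi>_add[of E1 E3] \<phi>_add[of E2 E3] by (auto simp: E \<phi>1 add.commute)
  \<comment> \<open>All idempotents of \<open>L\<close> lie in \<open>A\<close>, so the parts of the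
    decomposition used below are admissible in the definition of primitivity.\<close>
  have idem_A: "f \<in> A" if "f * f = f" for f using idempotent_mult_A[OF that A_one] by simp
  have split: "f = E" if f: "primitive_idempotent A f" and E: "E * E = E" "E \<noteq> 0" "f * E = E" for f E
  proof -
    have ff: "f * f = f" using f by (simp add: primitive_idempotent_def)
    have fE: "(f - E) * (f - E) = f - E" "E * (f - E) = 0"
      using ff E by (simp_all add: algebra_simps)
    have decomp: "\<forall>g\<in>A. \<forall>h\<in>A. g * g = g \<and> h * h = h \<and> g * h = 0 \<and> f = g + h \<longrightarrow> g = 0 \<or> h = 0"
      using f by (simp add: primitive_idempotent_def)
    have "E = 0 \<or> f - E = 0"
      by (intro decomp[rule_format] conjI idem_A fE E(1)) simp
    then show ?thesis using E by simp
  qed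
  have cases: "f = E1 \<or> f = E2 \<or> f = E3" if f: "primitive_idempotent A f" for f
  proof -
    obtain a b c where abc: "\<phi> f = (a, b, c)" by (cases "\<phi> f") auto
    have "\<phi> f \<in> K \<times> K \<times> K" using bij by (auto simp: bij_betw_def)
    then have K: "a \<in> K" "b \<in> K" "c \<in> K" by (simp_all add: abc)
    have "f * f = f" "f \<noteq> 0" using f by (simp_all add: primitive_idempotent_def)
    then have sq: "a * a = a" "b * b = b" "c * c = c" and nz: "a \<noteq> 0 \<or> b \<noteq> 0 \<or> c \<noteq> 0"
      using \<phi>_mult[of f f] inj[of f 0] by (auto simp: abc \<phi>0)
    have one: "x = 1" if "x \<in> K" "x * x = x" "x \<noteq> 0" for x
      using K_cancel[of x "x - 1"] that by (simp add: right_diff_distrib)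
    from nz consider "a = 1" | "b = 1" | "c = 1" using one K sq by blast
    then show ?thesis
    proof cases
      case 1
      then have "f * E1 = E1" by (intro inj) (simp add: \<phi>_mult E abc)
      then have "f = E1" by (rule split[OF f E_idem(1) E_nz(1)])
      then show ?thesis ..
    next
      case 2
      then have "f * E2 = E2" by (intro inj) (simp add: \<phi>_mult E abc)
      then have "f = E2" by (rule split[OF f E_idem(2) E_nz(2)])
      then show ?thesis by simp
    next
      case 3
      then have "f * E3 = E3" by (intro inj) (simp add: \<phi>_mult E abc)
      then have "f = E3" by (rule split[OF f E_idem(3) E_nz(3)])
      then show ?thesis by simp
    qed
  qed
  show "e * e' = 0" "e + e' \<noteq> 1"
    using cases[OF prim(1)] cases[OF prim(2)] prim(3) E_mult E_add by auto
qed

text \<open>On e and e' the element \<alpha> has coordinates 1 and t^q a, so \<alpha>^2 - \<alpha> =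
  t^q c e' with c = a (t^q a - 1). The condition on a for q = 0 makes c a unit in that case; for
  positive q it is one automatically. In the three branches the system 1, \<alpha>, c e' is then
  triangular modulo t.\<close>

lemma dual_three:
  assumes branches: "three_branches K" and adm: "admissible_three D A t q \<alpha>"
    and cubic: "cubic_ring D B" and B: "B = D + (t ^ k) *o C_three D A t l q \<alpha>"
  shows "dual_isomorphic_to D B (D + (t ^ l * \<alpha>) *o D + (t ^ (k + 2 * l + q)) *o A)"
proof -
  obtain e e' a where prim: "primitive_idempotent A e" "primitive_idempotent A e'" "e \<noteq> e'"
    and a: "a \<in> Units (ring_on 1 D)" "q = 0 \<Longrightarrow> a - 1 \<notin> t *o D" and \<alpha>: "\<alpha> = e + t ^ q * a * e'"
    using adm unfolding admissible_three_def by blast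
  have idem: "e * e = e" "e' * e' = e'" and nz: "e \<noteq> 0" "e' \<noteq> 0" and eA: "e \<in> A" "e' \<in> A"
    using prim by (simp_all add: primitive_idempotent_def)
  note ee' = three_branches_idempotents[OF branches prim]
  have e'e: "e' * e = 0" using ee'(1) by (simp add: mult.commute)
  obtain a' where aD: "a \<in> D" and a': "a' \<in> D" "a * a' = 1" using a(1) by (auto simp: Units_def)
  define c where "c = a * (t ^ q * a - 1)"
  have c: "c \<in> D" using aD by (simp add: c_def)
  have c_unit: "c \<notin> t *o D"
  proof
    assume "c \<in> t *o D"
    then have "a' * c \<in> t *o D" using tD_closed(4) a'(1) by blast
    moreover have "a' * c = t ^ q * a - 1"
      using a'(2) by (simp add: c_def mult.commute[of a a'] flip: mult.assoc)
    ultimately have *: "t ^ q * a - 1 \<in> t *o D" by simp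
    show False
    proof (cases q)
      case 0
      then show False using * a(2) by simp
    next
      case (Suc p)
      have "t ^ q * a \<in> t *o D" using set_times_intro2[of "t ^ p * a" D t] aD by (simp add: Suc mult.assoc)
      then have "t ^ q * a - (t ^ q * a - 1) \<in> t *o D" using * by (rule tD_closed(3))
      then show False using one_notin_tD by simp
    qed
  qed
  have "dual_isomorphic_to D B (D + (t ^ l * \<alpha>) *o D + (t ^ (k + (2 * l + q))) *o A)"
  proof (rule dual_isomorphic_to_of_basis[where \<delta> = "c * e'", OF _ _ _ _ _ _ _ cubic
        B[unfolded C_three_def]])
    show "\<alpha> \<in> A" "c * e' \<in> A" using eA aD c by (simp_all add: \<alpha> A_add A_scale)
    have "\<alpha> * (c * e') = c * (e * e') + t ^ q * a * c * (e' * e')" by (simp add: \<alpha> algebra_simps)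
    then show "\<alpha> * (c * e') \<in> A" using eA aD c by (simp add: ee' idem A_scale)
    have "\<alpha> * \<alpha> = e * e + t ^ q * a * (e * e' + e' * e) + t ^ q * a * (t ^ q * a) * (e' * e')"
      by (simp add: \<alpha> algebra_simps)
    also have "\<dots> = \<alpha> + t ^ q * (c * e')" by (simp add: idem ee' e'e \<alpha> c_def algebra_simps)
    finally have square: "\<alpha> * \<alpha> = \<alpha> + t ^ q * (c * e')" .
    have "(t ^ l * \<alpha>)\<^sup>2 = t ^ l * t ^ l * (\<alpha> * \<alpha>)" by (simp add: power2_eq_square mult_ac)
    also have "\<dots> = t ^ l * (t ^ l * \<alpha>) + t ^ l * t ^ l * t ^ q * (c * e')"
      unfolding square by (simp add: distrib_left mult_ac)
    also have "t ^ l * t ^ l * t ^ q = t ^ (2 * l + q)" by (simp add: mult_2 power_add)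
    finally show "(t ^ l * \<alpha>)\<^sup>2 = t ^ l * (t ^ l * \<alpha>) + t ^ (2 * l + q) * (c * e')" .
    fix d1 d2 d3 assume d: "d1 \<in> D" "d2 \<in> D" "d3 \<in> D" and "d1 + d2 * \<alpha> + d3 * (c * e') \<in> t *o A"
    then obtain x where x: "x \<in> A" "d1 + d2 * \<alpha> + d3 * (c * e') = t * x" unfolding mem_elt_times by blast
    have project: "y \<in> t *o D"
      if f: "f * f = f" "f \<noteq> 0" and y: "y \<in> D" "f * (d1 + d2 * \<alpha> + d3 * (c * e')) = f * y" for f y
    proof (rule idempotent_mult_in_tA[OF f y(1)])
      have "f * y = t * (f * x)" unfolding y(2)[symmetric] x(2) by (rule mult.left_commute)
      then show "f * y \<in> t *o A" using set_times_intro2[OF idempotent_mult_A[OF f(1) x(1)], of t] by simp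
    qed
    have expand: "f * (d1 + d2 * \<alpha> + d3 * (c * e'))
        = f * d1 + d2 * (f * e) + (d2 * (t ^ q * a) + d3 * c) * (f * e')" for f
      by (simp add: \<alpha> algebra_simps)
    \<comment> \<open>The third idempotent kills \<alpha> and e', so it isolates d1; projecting to e
      and then to e' gives d2 and d3.\<close>
    define f where "f = 1 - e - e'"
    have f: "f * e = 0" "f * e' = 0" by (simp_all add: f_def left_diff_distrib idem ee' e'e)
    have "f * f = f - f * e - f * e'" by (simp add: f_def right_diff_distrib)
    then have ff: "f * f = f" by (simp add: f)
    have "f \<noteq> 0" using ee'(2) by (auto simp: f_def algebra_simps)
    then have d1: "d1 \<in> t *o D" using ff d(1) by (intro project[of f]) (simp_all add: expand f)
    have "e * (d1 + d2 * \<alpha> + d3 * (c * e')) = e * (d1 + d2)"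
      unfolding expand idem ee'(1) by (simp add: algebra_simps)
    then have "d1 + d2 \<in> t *o D" using d by (intro project[OF idem(1) nz(1)]) simp_all
    then have "d1 + d2 - d1 \<in> t *o D" using d1 by (rule tD_closed(3))
    then have d2: "d2 \<in> t *o D" by simp
    have "e' * (d1 + d2 * \<alpha> + d3 * (c * e')) = e' * (d1 + (t ^ q * a * d2 + c * d3))"
      unfolding expand idem e'e by (simp add: algebra_simps)
    then have sum: "d1 + (t ^ q * a * d2 + c * d3) \<in> t *o D"
      using d aD c by (intro project[OF idem(2) nz(2)]) simp_all
    have "t ^ q * a * d2 \<in> t *o D" using tD_closed(4)[OF _ d2] aD by simp
    then have "d1 + (t ^ q * a * d2 + c * d3) - (d1 + t ^ q * a * d2) \<in> t *o D"
      by (intro tD_closed(3)[OF sum] tD_closed(2)[OF d1])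
    then have "c * d3 \<in> t *o D" by simp
    then show "d1 \<in> t *o D \<and> d2 \<in> t *o D \<and> d3 \<in> t *o D"
      using tD_prime[OF c d(3)] c_unit d1 d2 by blast
  qed simp_all
  then show ?thesis by (simp add: add.assoc)
qed

end

theorem theorem3p1:
  fixes K D A :: "'a::comm_ring_1 set" and t :: 'a
  assumes "cubic_setting K D A t"
  shows
    "(\<forall>\<tau>. one_branch_ramified D A t \<tau> \<longrightarrow>
        (\<forall>k r \<alpha> B. admissible_one_ramified A \<tau> r \<alpha> \<and> cubic_ring D B \<and>
           B = D + (t ^ k) *o C_one_ramified D A t r \<alpha> \<longrightarrow>
           dual_isomorphic_to D B (D + (t ^ (r div 2) * \<alpha>) *o D + (t ^ (k + r)) *o A))) \<and>
     (one_branch_unramified D A t \<longrightarrow>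
        (\<forall>k r \<alpha> B. admissible_one_unramified D A t \<alpha> \<and> cubic_ring D B \<and>
           B = D + (t ^ k) *o C_one_unramified D A t r \<alpha> \<longrightarrow>
           dual_isomorphic_to D B (D + (t ^ r * \<alpha>) *o D + (t ^ (k + 2 * r)) *o A))) \<and>
     (\<forall>e \<tau>. two_branches_ramified K D A t e \<tau> \<longrightarrow>
        (\<forall>k l q \<alpha> B. admissible_two_ramified A e \<tau> \<alpha> \<and> cubic_ring D B \<and>
           B = D + (t ^ k) *o C_two D A t e l q \<alpha> \<longrightarrow>
           dual_isomorphic_to D B
             (D + (t ^ l * (e + t ^ q * \<alpha>)) *o D + (t ^ (k + 2 * l + q)) *o A)) \<and>
        (\<forall>k r \<alpha> B. admissible_two_ramified A e \<tau> \<alpha> \<and> cubic_ring D B \<and>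
           B = D + (t ^ k) *o C_two_ramified D A t r \<alpha> \<longrightarrow>
           dual_isomorphic_to D B (D + (t ^ r * \<alpha>) *o D + (t ^ (k + 2 * r + 1)) *o A))) \<and>
     (\<forall>e. two_branches_unramified K D A t e \<longrightarrow>
        (\<forall>k l q \<alpha> B. admissible_two_unramified D A t e \<alpha> \<and> cubic_ring D B \<and>
           B = D + (t ^ k) *o C_two D A t e l q \<alpha> \<longrightarrow>
           dual_isomorphic_to D B
             (D + (t ^ l * (e + t ^ q * \<alpha>)) *o D + (t ^ (k + 2 * l + q)) *o A))) \<and>
     (three_branches K \<longrightarrow>
        (\<forall>k l q \<alpha> B. admissible_three D A t q \<alpha> \<and> cubic_ring D B \<and>
           B = D + (t ^ k) *o C_three D A t l q \<alpha> \<longrightarrow>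
           dual_isomorphic_to D B (D + (t ^ l * \<alpha>) *o D + (t ^ (k + 2 * l + q)) *o A)))"
proof -
  interpret cubic_setting K D A t by fact
  have branches: "e * e = e" "e \<noteq> 1" if "two_branches K e" for e
    using that two_branches_ne_one[OF that] K_closed(1,2) by (auto simp: two_branches_def)
  show ?thesis
  proof (intro conjI allI impI; (elim conjE)?)
    fix \<tau> k r \<alpha> B
    assume branch: "one_branch_ramified D A t \<tau>" and B: "admissible_one_ramified A \<tau> r \<alpha>" "cubic_ring D B"
      "B = D + (t ^ k) *o C_one_ramified D A t r \<alpha>"
    interpret local_factor K D A t 1 A \<tau> 3
      by unfold_locales (use branch in \<open>auto simp: one_branch_ramified_def\<close>)
    show "dual_isomorphic_to D B (D + (t ^ (r div 2) * \<alpha>) *o D + (t ^ (k + r)) *o A)"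
      by (rule dual_one_ramified[OF refl refl B])
  next
    fix k r \<alpha> B
    assume branch: "one_branch_unramified D A t" and B: "admissible_one_unramified D A t \<alpha>" "cubic_ring D B"
      "B = D + (t ^ k) *o C_one_unramified D A t r \<alpha>"
    interpret local_factor K D A t 1 A t 1
      by unfold_locales (use branch in \<open>auto simp: one_branch_unramified_def\<close>)
    have "residue_extension_degree D 1 A (t *o A) 3" using branch by (simp add: one_branch_unramified_def)
    then show "dual_isomorphic_to D B (D + (t ^ r * \<alpha>) *o D + (t ^ (k + 2 * r)) *o A)"
      by (rule dual_one_unramified[OF refl refl _ B])
  next
    fix e \<tau> k l q \<alpha> B
    assume branch: "two_branches_ramified K D A t e \<tau>" and B: "admissible_two_ramified A e \<tau> \<alpha>"
      "cubic_ring D B" "B = D + (t ^ k) *o C_two D A t e l q \<alpha>"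
    have "two_branches K e" using branch by (simp add: two_branches_ramified_def)
    note e = branches[OF this]
    interpret local_factor K D A t e "e *o A" \<tau> 2
      by unfold_locales (use branch e in \<open>auto simp: two_branches_ramified_def\<close>)
    show "dual_isomorphic_to D B
        (D + (t ^ l * (e + t ^ q * \<alpha>)) *o D + (t ^ (k + 2 * l + q)) *o A)"
      by (rule dual_two_ramified(1)[OF e(2) refl B])
  next
    fix e \<tau> k r \<alpha> B
    assume branch: "two_branches_ramified K D A t e \<tau>" and B: "admissible_two_ramified A e \<tau> \<alpha>"
      "cubic_ring D B" "B = D + (t ^ k) *o C_two_ramified D A t r \<alpha>"
    have "two_branches K e" using branch by (simp add: two_branches_ramified_def)
    note e = branches[OF this]
    interpret local_factor K D A t e "e *o A" \<tau> 2
      by unfold_locales (use branch e in \<open>auto simp: two_branches_ramified_def\<close>)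
    show "dual_isomorphic_to D B (D + (t ^ r * \<alpha>) *o D + (t ^ (k + 2 * r + 1)) *o A)"
      by (rule dual_two_ramified(2)[OF e(2) refl B])
  next
    fix e k l q \<alpha> B
    assume branch: "two_branches_unramified K D A t e" and B: "admissible_two_unramified D A t e \<alpha>"
      "cubic_ring D B" "B = D + (t ^ k) *o C_two D A t e l q \<alpha>"
    have "two_branches K e" using branch by (simp add: two_branches_unramified_def)
    note e = branches[OF this]
    interpret local_factor K D A t e "e *o A" t 1
      by unfold_locales (use branch e in \<open>auto simp: two_branches_unramified_def\<close>)
    show "dual_isomorphic_to D B
        (D + (t ^ l * (e + t ^ q * \<alpha>)) *o D + (t ^ (k + 2 * l + q)) *o A)"
      by (rule dual_two_unramified[OF e(2) refl refl B])
  next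
    fix k l q \<alpha> B
    assume "three_branches K" "admissible_three D A t q \<alpha>" "cubic_ring D B"
      "B = D + (t ^ k) *o C_three D A t l q \<alpha>"
    then show "dual_isomorphic_to D B (D + (t ^ l * \<alpha>) *o D + (t ^ (k + 2 * l + q)) *o A)"
      by (rule dual_three)
  qed
qed

end
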